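(* Let $\Omega,\Omega'$ be comparable io-programs with placeholders $\mathit{PH}$ that are locally tight under an assumption $A$. Then $\Omega$ and $\Omega'$ are equivalent to each other under the assumption $A$ if and only if the sentence $A\to(\mathrm{comp}[\Omega]\leftrightarrow\mathrm{comp}[\Omega'])$ is satisfied by all interpretations of $\sigma_0$ that are standard for $\mathit{PH}$.
   Context: Mini-gringo syntax. Fix disjoint countably infinite sets of numerals, symbolic constants and variables; $\overline n$ is the numeral for the integer $n$. Precomputed terms are numerals and symbolic constants; a total order on them is fixed with $\overline m<\overline n$ iff $m<n$. Terms are built from precomputed terms and variables with $|\cdot|$ and binary $+,-,\times,/,\backslash,..$. An atom is $p(t_1,\dots,t_n)$ ($p$ a symbolic constant; predicate symbol $p/n$); precomputed if all $t_i$ are precomputed. Literals: $A$, $\mathit{not}\ A$, $\mathit{not}\ \mathit{not}\ A$. Comparisons: $t_1\prec t_2$, $\prec\in\{=,\neq,<,>,\le,\ge\}$. A rule is $\mathit{Head}\leftarrow\mathit{Body}$, $\mathit{Body}$ a possibly empty conjunction of literals and comparisons, $\mathit{Head}$ an atom (basic rule), $\{A\}$ (choice rule) or empty (constraint); a program is a finite set of rules; a fact is a ground basic rule with empty body. An instance of a rule substitutes precomputed terms for all its variables. Values of ground terms: $[t]=\{t\}$ for precomputed $t$; $[|t_1|]=\{\overline{|n|}:\overline n\in[t_1]\}$; $[t_1\,\mathit{op}\,t_2]=\{\overline{n_1\,\mathit{op}\,n_2}:\overline{n_i}\in[t_i]\}$ for $\mathit{op}\in\{+,-,\times\}$; $[t_1/t_2]=\{\overline{\mathit{round}(n_1/n_2)}:\overline{n_i}\in[t_i],n_2\ne0\}$;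 $[t_1\backslash t_2]=\{\overline{n_1-n_2\,\mathit{round}(n_1/n_2)}:\overline{n_i}\in[t_i],n_2\ne0\}$; $[t_1..t_2]=\{\overline m:n_1\le m\le n_2,\overline{n_i}\in[t_i]\}$; $\mathit{round}$ truncates toward zero. $[\mathbf t]$ is componentwise. Stable models of programs. $\tau(p(\mathbf t))=\bigvee_{\mathbf r\in[\mathbf t]}p(\mathbf r)$, $\tau(\mathit{not}\ p(\mathbf t))=\bigvee_{\mathbf r\in[\mathbf t]}\neg p(\mathbf r)$, $\tau(\mathit{not}\ \mathit{not}\ p(\mathbf t))=\bigvee_{\mathbf r\in[\mathbf t]}\neg\neg p(\mathbf r)$; $\tau(t_1\prec t_2)$ is $\top$ if $\prec$ holds for some $r_1\in[t_1],r_2\in[t_2]$, else $\bot$; bodies to conjunctions; $\tau(p(\mathbf t)\leftarrow B)=\tau B\to\bigwedge_{\mathbf r\in[\mathbf t]}p(\mathbf r)$; $\tau(\{p(\mathbf t)\}\leftarrow B)=\tau B\to\bigwedge_{\mathbf r\in[\mathbf t]}(p(\mathbf r)\lor\neg p(\mathbf r))$; $\tau(\leftarrow B)=\neg\tau B$. Stable models of $\Pi$ are the stable models (Ferraris 2005) of $\{\tau R: R$ an instance of a rule of $\Pi\}$. IO-programs. $\Omega=(\Pi,\mathit{PH},\mathit{In},\mathit{Out})$ with $\mathit{PH}$ a finite set of symbolic constants (placeholders), $\mathit{In},\mathit{Out}$ disjoint finite sets of predicate symbols, no input symbol in rule heads of $\Pi$. Public symbols: input and output symbols; private: other predicate symbols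 of $\Pi$. A valuation $v$ on $\mathit{PH}$ maps placeholders to precomputed terms not in $\mathit{PH}$; an input is $(v,\mathcal I)$ with $\mathcal I$ a set of precomputed input atoms without placeholders; $v(\Pi)$, $v(F)$ replace each $c\in\mathit{PH}$ by $v(c)$. An io-model of $\Omega$ for $(v,\mathcal I)$ is the set of public atoms of a stable model of $v(\Pi)\cup\mathcal I$. Two io-programs are comparable if they have the same placeholders, input symbols and output symbols. An assumption for $\Omega$ is a sentence over $\sigma_0$ in which every predicate symbol $p/n$ occurring is an input symbol; the domain it defines is the set of inputs $(v,\mathcal I)$ with $\mathcal I^v\models A$. Comparable $\Omega,\Omega'$ are equivalent under $A$ if for every input in the domain defined by $A$ they have the same io-models. $\Omega$ is locally tight under $A$ if it is locally tight for every input in that domain. Positive dependency graph of $\Omega$ for $(v,\mathcal I)$: vertices are ground atoms $p(\mathbf r)$ with $p$ output or private and components precomputed terms not in $\mathit{PH}$; edge $p(\mathbf r)\to p'(\mathbf r')$ iff some ground instance $R$ of a rule of $v(\Pi)$ has (a) head $p(\mathbf t)$ or $\{p(\mathbf t)\}$ with $\mathbf r\in[\mathbf t]$; (b) a body conjunctive term $p'(\mathbf t)$ with $\mathbf r'\in[\mathbf t]$; (c) for each body term with input symbol of form $q(\mathbf t)$ or $\mathit{not}\ \mathit{not}\ q(\mathbf t)$, some $\mathbf r''\in[\mathbf t]$ with $q(\mathbf r'')\in\mathcal I$; (d) for each body term with input symbol of form $\mathit{not}\ q(\mathbf t)$, some $\mathbf r''\in[\mathbf t]$ with $q(\mathbf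 r'')\notin\mathcal I$; (e) for each comparison $t_1\prec t_2$ in the body, some $r_1\in[t_1],r_2\in[t_2]$ with $r_1\prec r_2$. Locally tight on $(v,\mathcal I)$: the graph has no infinite walk. Signature $\sigma_0$: sorts general and subsort integer; precomputed terms as object constants (numerals of sort integer); $|\cdot|,+,-,\times$ function constants on integers; $p/n$ as $n$-ary predicate constants on sort general; $\neq,<,>,\le,\ge$ binary predicate constants on sort general. An interpretation is standard for $\mathit{PH}$ if its general domain is the set of precomputed terms, its integer domain the set of numerals, $|\cdot|,+,-,\times$ are arithmetic, comparisons follow the fixed order, each constant in $\mathit{PH}$ denotes a precomputed term not in $\mathit{PH}$, and each other object constant denotes itself. $\mathcal J^v$ is the interpretation standard for $\mathit{PH}$ where $c\in\mathit{PH}$ denotes $v(c)$ and the true precomputed atoms are those of $\mathcal J$. Translation $\tau^*$. $\mathit{val}_t(V)$: $V=t$ for precomputed $t$ or variable; $\exists I(\mathit{val}_{t_1}(I)\land V=|I|)$ for $|t_1|$; $\exists IJ(\mathit{val}_{t_1}(I)\land\mathit{val}_{t_2}(J)\land V=I\,\mathit{op}\,J)$ for $\mathit{op}\in\{+,-,\times\}$; for $t_1/t_2$: $\exists IJK(\mathit{val}_{t_1}(I)\land\mathit{val}_{t_2}(J)\land K\times|J|\le|I|<(K+\overline1)\times|J|\land((I\times J\ge\overline0\land V=K)\lor(I\times J<\overline0\land V=-K)))$; for $t_1\backslash t_2$ the same with $V=I-K\times J$, $V=I+K\times J$; for $t_1..t_2$: $\exists IJK(\mathit{val}_{t_1}(I)\land\mathit{val}_{t_2}(J)\land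 I\le K\le J\land V=K)$; $I,J,K$ fresh integer variables. $\tau^B$: $p(\mathbf t)\mapsto\exists\mathbf V(\mathit{val}_{\mathbf t}(\mathbf V)\land p(\mathbf V))$, $\mathit{not}\ p(\mathbf t)\mapsto\exists\mathbf V(\mathit{val}_{\mathbf t}(\mathbf V)\land\neg p(\mathbf V))$, $\mathit{not}\ \mathit{not}\ p(\mathbf t)\mapsto\exists\mathbf V(\mathit{val}_{\mathbf t}(\mathbf V)\land\neg\neg p(\mathbf V))$, $t_1\prec t_2\mapsto\exists V_1V_2(\mathit{val}_{t_1}(V_1)\land\mathit{val}_{t_2}(V_2)\land V_1\prec V_2)$. $\tau^*(p(\mathbf t)\leftarrow B)=\widetilde\forall(\mathit{val}_{\mathbf t}(\mathbf V)\land\tau^B(B)\to p(\mathbf V))$, $\tau^*(\{p(\mathbf t)\}\leftarrow B)=\widetilde\forall(\mathit{val}_{\mathbf t}(\mathbf V)\land\tau^B(B)\land\neg\neg p(\mathbf V)\to p(\mathbf V))$, $\tau^*(\leftarrow B)=\widetilde\forall(\tau^B(B)\to\bot)$; $\mathbf V$ the alphabetically first general variables not in $\Pi$. Completion. Output and private symbols are intensional, input and comparison symbols extensional. A finite set $\Gamma$ of sentences $\widetilde\forall(F\to G)$, where each $G$ has no intensional symbol or is $p(\mathbf V)$ with $p$ intensional and distinct variables $\mathbf V$, and members with consequents containing the same intensional symbol have identical consequents, is completable ($\tau^*\Pi$ is). The completed definition of $p$ with defining members $\widetilde\forall(F_i(\mathbf V)\to p(\mathbf V))$ is $\forall\mathbf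 V(p(\mathbf V)\leftrightarrow\bigvee_i\exists\mathbf U_iF_i(\mathbf V))$, $\mathbf U_i$ the free variables of $F_i(\mathbf V)$ not in $\mathbf V$; $\mathrm{comp}[\Gamma]$ is the conjunction of completed definitions of all intensional symbols and of the members whose consequents have no intensional symbol. $\mathrm{comp}[\Omega]=\exists P_1\cdots P_l\,C$ with $C$ obtained from $\mathrm{comp}[\tau^*\Pi]$ by replacing the private symbols by distinct predicate variables $P_1,\dots,P_l$.
   Formalization: Inputs and vertices of the positive dependency graph may contain placeholders (all precomputed terms allowed), in local tightness, domain and equivalence; with the exclusion the claim fails, e.g. A = ∀X q(X), PH = {c}: no input satisfies A. With PH empty nothing changes. *)

theory Defs
  imports Complex_Main "HOL-Library.Countable" "HOL-Library.Infinite_Set"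
    "HOL-Library.Infinite_Typeclass"
begin

section \<open>Finite sets as lists\<close>

text \<open>Conjunctions, disjunctions and blocks of quantifiers indexed by a finite set are formed
  along an arbitrary but fixed enumeration of the set.\<close>

definition listing :: "'a set \<Rightarrow> 'a list" where
  "listing A = (SOME xs. distinct xs \<and> set xs = A)"

lemma listing:
  assumes "finite A"
  shows "distinct (listing A)" "set (listing A) = A"
  using someI_ex[of "\<lambda>xs. distinct xs \<and> set xs = A"] finite_distinct_list[OF assms]
  unfolding listing_def by blast+

section \<open>Syntax of mini-gringo\<close>

datatype 's pterm = Num int | Sym 's

primrec the_int :: "'s pterm \<Rightarrow> int" where
  "the_int (Num n) = n"

datatype aop = Plus | Minus | Times
datatype binop = Arith aop | Div | Mod | Interval

text \<open>Variables are the natural numbers; their usual order plays the role of the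
  alphabetical order.\<close>

datatype 's tm = Pre "'s pterm" | Var nat | TAbs "'s tm" | Bin binop "'s tm" "'s tm"

datatype rel = EQ | NE | LT | GT | LE | GE

datatype 's blit =
    Pos 's "'s tm list"
  | Naf 's "'s tm list"
  | NafNaf 's "'s tm list"
  | Comp rel "'s tm" "'s tm"

datatype 's head = Basic 's "'s tm list" | Choice 's "'s tm list" | Constraint

datatype 's rule = Rule (hd_of: "'s head") (body_of: "'s blit list")

text \<open>A predicate symbol \<open>p/n\<close> is the pair \<open>(p, n)\<close>.\<close>

type_synonym 's psym = "'s \<times> nat"
type_synonym 's patom = "'s \<times> 's pterm list"

definition pred_of :: "'s patom \<Rightarrow> 's psym" where
  "pred_of a = (fst a, length (snd a))"

definition fact_rule :: "'s patom \<Rightarrow> 's rule" where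
  "fact_rule a = Rule (Basic (fst a) (map Pre (snd a))) []"

primrec tm_vars :: "'s tm \<Rightarrow> nat set" where
  "tm_vars (Pre r) = {}"
| "tm_vars (Var x) = {x}"
| "tm_vars (TAbs t) = tm_vars t"
| "tm_vars (Bin f t u) = tm_vars t \<union> tm_vars u"

primrec blit_vars :: "'s blit \<Rightarrow> nat set" where
  "blit_vars (Pos p ts) = (\<Union>t\<in>set ts. tm_vars t)"
| "blit_vars (Naf p ts) = (\<Union>t\<in>set ts. tm_vars t)"
| "blit_vars (NafNaf p ts) = (\<Union>t\<in>set ts. tm_vars t)"
| "blit_vars (Comp c t u) = tm_vars t \<union> tm_vars u"

primrec head_vars :: "'s head \<Rightarrow> nat set" where
  "head_vars (Basic p ts) = (\<Union>t\<in>set ts. tm_vars t)"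
| "head_vars (Choice p ts) = (\<Union>t\<in>set ts. tm_vars t)"
| "head_vars Constraint = {}"

definition rule_vars :: "'s rule \<Rightarrow> nat set" where
  "rule_vars R = head_vars (hd_of R) \<union> (\<Union>l\<in>set (body_of R). blit_vars l)"

definition program_vars :: "'s rule set \<Rightarrow> nat set" where
  "program_vars \<Pi> = (\<Union>R\<in>\<Pi>. rule_vars R)"

primrec blit_preds :: "'s blit \<Rightarrow> 's psym set" where
  "blit_preds (Pos p ts) = {(p, length ts)}"
| "blit_preds (Naf p ts) = {(p, length ts)}"
| "blit_preds (NafNaf p ts) = {(p, length ts)}"
| "blit_preds (Comp c t u) = {}"

primrec head_preds :: "'s head \<Rightarrow> 's psym set" where
  "head_preds (Basic p ts) = {(p, length ts)}"
| "head_preds (Choice p ts) = {(p, length ts)}"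
| "head_preds Constraint = {}"

definition rule_preds :: "'s rule \<Rightarrow> 's psym set" where
  "rule_preds R = head_preds (hd_of R) \<union> (\<Union>l\<in>set (body_of R). blit_preds l)"

definition program_preds :: "'s rule set \<Rightarrow> 's psym set" where
  "program_preds \<Pi> = (\<Union>R\<in>\<Pi>. rule_preds R)"

text \<open>\<open>map_rule_tms\<close> applies a function on terms to every argument of every atom and
  comparison; it serves both for forming instances and for replacing placeholders.  Predicate
  symbols are not affected, even if their names are placeholders.\<close>

primrec map_blit_tms :: "('s tm \<Rightarrow> 's tm) \<Rightarrow> 's blit \<Rightarrow> 's blit" where
  "map_blit_tms f (Pos p ts) = Pos p (map f ts)"
| "map_blit_tms f (Naf p ts) = Naf p (map f ts)"
| "map_blit_tms f (NafNaf p ts) = NafNaf p (map f ts)"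
| "map_blit_tms f (Comp c t u) = Comp c (f t) (f u)"

primrec map_head_tms :: "('s tm \<Rightarrow> 's tm) \<Rightarrow> 's head \<Rightarrow> 's head" where
  "map_head_tms f (Basic p ts) = Basic p (map f ts)"
| "map_head_tms f (Choice p ts) = Choice p (map f ts)"
| "map_head_tms f Constraint = Constraint"

definition map_rule_tms :: "('s tm \<Rightarrow> 's tm) \<Rightarrow> 's rule \<Rightarrow> 's rule" where
  "map_rule_tms f R = Rule (map_head_tms f (hd_of R)) (map (map_blit_tms f) (body_of R))"

primrec subst_tm :: "(nat \<Rightarrow> 's pterm) \<Rightarrow> 's tm \<Rightarrow> 's tm" where
  "subst_tm \<sigma> (Pre r) = Pre r"
| "subst_tm \<sigma> (Var x) = Pre (\<sigma> x)"
| "subst_tm \<sigma> (TAbs t) = TAbs (subst_tm \<sigma> t)"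
| "subst_tm \<sigma> (Bin f t u) = Bin f (subst_tm \<sigma> t) (subst_tm \<sigma> u)"

definition instances :: "'s rule set \<Rightarrow> 's rule set" where
  "instances \<Pi> = {map_rule_tms (subst_tm \<sigma>) R | \<sigma> R. R \<in> \<Pi>}"

definition apply_val :: "'s set \<Rightarrow> ('s \<Rightarrow> 's pterm) \<Rightarrow> 's pterm \<Rightarrow> 's pterm" where
  "apply_val PH v r = (case r of Num n \<Rightarrow> Num n | Sym c \<Rightarrow> if c \<in> PH then v c else Sym c)"

primrec val_tm :: "'s set \<Rightarrow> ('s \<Rightarrow> 's pterm) \<Rightarrow> 's tm \<Rightarrow> 's tm" where
  "val_tm PH v (Pre r) = Pre (apply_val PH v r)"
| "val_tm PH v (Var x) = Var x"
| "val_tm PH v (TAbs t) = TAbs (val_tm PH v t)"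
| "val_tm PH v (Bin f t u) = Bin f (val_tm PH v t) (val_tm PH v u)"

definition val_program :: "'s set \<Rightarrow> ('s \<Rightarrow> 's pterm) \<Rightarrow> 's rule set \<Rightarrow> 's rule set" where
  "val_program PH v \<Pi> = map_rule_tms (val_tm PH v) ` \<Pi>"

section \<open>Values of ground terms\<close>

definition precomputed_order :: "('s pterm \<Rightarrow> 's pterm \<Rightarrow> bool) \<Rightarrow> bool" where
  "precomputed_order lt \<longleftrightarrow>
     class.linorder (\<lambda>r s. lt r s \<or> r = s) lt \<and> (\<forall>m n. lt (Num m) (Num n) \<longleftrightarrow> m < n)"

fun rel_holds :: "('s pterm \<Rightarrow> 's pterm \<Rightarrow> bool) \<Rightarrow> rel \<Rightarrow> 's pterm \<Rightarrow> 's pterm \<Rightarrow> bool" where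
  "rel_holds lt EQ r s \<longleftrightarrow> r = s"
| "rel_holds lt NE r s \<longleftrightarrow> r \<noteq> s"
| "rel_holds lt LT r s \<longleftrightarrow> lt r s"
| "rel_holds lt GT r s \<longleftrightarrow> lt s r"
| "rel_holds lt LE r s \<longleftrightarrow> lt r s \<or> r = s"
| "rel_holds lt GE r s \<longleftrightarrow> lt s r \<or> r = s"

fun arith :: "aop \<Rightarrow> int \<Rightarrow> int \<Rightarrow> int" where
  "arith Plus m n = m + n"
| "arith Minus m n = m - n"
| "arith Times m n = m * n"

definition round0 :: "rat \<Rightarrow> int" where
  "round0 x = (if x \<ge> 0 then \<lfloor>x\<rfloor> else \<lceil>x\<rceil>)"

fun binop_vals :: "binop \<Rightarrow> int \<Rightarrow> int \<Rightarrow> int set" where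
  "binop_vals (Arith f) m n = {arith f m n}"
| "binop_vals Div m n = (if n \<noteq> 0 then {round0 (of_int m / of_int n)} else {})"
| "binop_vals Mod m n = (if n \<noteq> 0 then {m - n * round0 (of_int m / of_int n)} else {})"
| "binop_vals Interval m n = {m..n}"

text \<open>Only the values of ground terms matter; the clause for variables is a dummy.\<close>

primrec vals :: "'s tm \<Rightarrow> 's pterm set" where
  "vals (Pre r) = {r}"
| "vals (Var x) = {}"
| "vals (TAbs t) = {Num \<bar>n\<bar> | n. Num n \<in> vals t}"
| "vals (Bin f t u) =
     {Num k | k m n. Num m \<in> vals t \<and> Num n \<in> vals u \<and> k \<in> binop_vals f m n}"

definition tuple_vals :: "'s tm list \<Rightarrow> 's pterm list set" where
  "tuple_vals ts = listset (map vals ts)"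

lemma finite_vals: "finite (vals t)"
proof (induction t)
  case (TAbs t)
  have "vals (TAbs t) \<subseteq> (\<lambda>r. Num \<bar>the_int r\<bar>) ` vals t" by force
  then show ?case using TAbs finite_surj by blast
next
  case (Bin f t u)
  have "vals (Bin f t u) \<subseteq>
      (\<Union>r\<in>vals t. \<Union>s\<in>vals u. Num ` binop_vals f (the_int r) (the_int s))" by force
  moreover have "finite (binop_vals f m n)" for m n by (cases f) auto
  ultimately show ?case using Bin by (meson finite_UN finite_imageI finite_subset)
qed auto

lemma finite_tuple_vals:
  fixes ts :: "'s tm list"
  shows "finite (tuple_vals ts)"
proof -
  have "finite (listset As)" if "\<forall>A\<in>set As. finite A" for As :: "'s pterm set list"
    using that by (induction As) (auto simp: set_Cons_def intro: finite_image_set2)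
  then show ?thesis by (auto simp: tuple_vals_def finite_vals)
qed

section \<open>Propositional formulas and stable models\<close>

datatype 'a pf = PAtom 'a | PBot | PAnd "'a pf" "'a pf" | POr "'a pf" "'a pf" | PImp "'a pf" "'a pf"

definition PNot :: "'a pf \<Rightarrow> 'a pf" where "PNot F = PImp F PBot"
definition PTop :: "'a pf" where "PTop = PImp PBot PBot"
definition PConj :: "'a pf list \<Rightarrow> 'a pf" where "PConj Fs = foldr PAnd Fs PTop"
definition PDisj :: "'a pf list \<Rightarrow> 'a pf" where "PDisj Fs = foldr POr Fs PBot"

primrec psat :: "'a set \<Rightarrow> 'a pf \<Rightarrow> bool" where
  "psat X (PAtom a) \<longleftrightarrow> a \<in> X"
| "psat X PBot \<longleftrightarrow> False"
| "psat X (PAnd F G) \<longleftrightarrow> psat X F \<and> psat X G"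
| "psat X (POr F G) \<longleftrightarrow> psat X F \<or> psat X G"
| "psat X (PImp F G) \<longleftrightarrow> (psat X F \<longrightarrow> psat X G)"

text \<open>Ferraris' reduct: maximal subformulas not satisfied by \<open>X\<close> are replaced by falsity.\<close>

primrec reduct :: "'a set \<Rightarrow> 'a pf \<Rightarrow> 'a pf" where
  "reduct X (PAtom a) = (if psat X (PAtom a) then PAtom a else PBot)"
| "reduct X PBot = PBot"
| "reduct X (PAnd F G) = (if psat X (PAnd F G) then PAnd (reduct X F) (reduct X G) else PBot)"
| "reduct X (POr F G) = (if psat X (POr F G) then POr (reduct X F) (reduct X G) else PBot)"
| "reduct X (PImp F G) = (if psat X (PImp F G) then PImp (reduct X F) (reduct X G) else PBot)"

definition stable_model_pf :: "'a pf set \<Rightarrow> 'a set \<Rightarrow> bool" where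
  "stable_model_pf \<Gamma> X \<longleftrightarrow>
     (\<forall>F\<in>\<Gamma>. psat X (reduct X F)) \<and> (\<forall>Y. Y \<subset> X \<longrightarrow> \<not> (\<forall>F\<in>\<Gamma>. psat Y (reduct X F)))"

text \<open>The translation of ground rules; \<open>lt\<close> is the order on precomputed terms.\<close>

primrec tau_blit :: "('s pterm \<Rightarrow> 's pterm \<Rightarrow> bool) \<Rightarrow> 's blit \<Rightarrow> 's patom pf" where
  "tau_blit lt (Pos p ts) = PDisj (map (\<lambda>r. PAtom (p, r)) (listing (tuple_vals ts)))"
| "tau_blit lt (Naf p ts) = PDisj (map (\<lambda>r. PNot (PAtom (p, r))) (listing (tuple_vals ts)))"
| "tau_blit lt (NafNaf p ts) =
     PDisj (map (\<lambda>r. PNot (PNot (PAtom (p, r)))) (listing (tuple_vals ts)))"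
| "tau_blit lt (Comp c t u) =
     (if \<exists>r\<in>vals t. \<exists>s\<in>vals u. rel_holds lt c r s then PTop else PBot)"

definition tau_body :: "('s pterm \<Rightarrow> 's pterm \<Rightarrow> bool) \<Rightarrow> 's blit list \<Rightarrow> 's patom pf" where
  "tau_body lt B = PConj (map (tau_blit lt) B)"

definition tau_rule :: "('s pterm \<Rightarrow> 's pterm \<Rightarrow> bool) \<Rightarrow> 's rule \<Rightarrow> 's patom pf" where
  "tau_rule lt R =
     (case hd_of R of
        Basic p ts \<Rightarrow> PImp (tau_body lt (body_of R))
          (PConj (map (\<lambda>r. PAtom (p, r)) (listing (tuple_vals ts))))
      | Choice p ts \<Rightarrow> PImp (tau_body lt (body_of R))
          (PConj (map (\<lambda>r. POr (PAtom (p, r)) (PNot (PAtom (p, r)))) (listing (tuple_vals ts))))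
      | Constraint \<Rightarrow> PNot (tau_body lt (body_of R)))"

definition stable_model ::
    "('s pterm \<Rightarrow> 's pterm \<Rightarrow> bool) \<Rightarrow> 's rule set \<Rightarrow> 's patom set \<Rightarrow> bool" where
  "stable_model lt \<Pi> X \<longleftrightarrow> stable_model_pf (tau_rule lt ` instances \<Pi>) X"

section \<open>Programs with input and output\<close>

record 's io_prog =
  rules :: "'s rule set"
  placeholders :: "'s set"
  ins :: "'s psym set"
  outs :: "'s psym set"

definition io_program :: "'s io_prog \<Rightarrow> bool" where
  "io_program \<Omega> \<longleftrightarrow>
     finite (rules \<Omega>) \<and> finite (placeholders \<Omega>) \<and> finite (ins \<Omega>) \<and> finite (outs \<Omega>) \<and>
     ins \<Omega> \<inter> outs \<Omega> = {} \<and> (\<forall>R\<in>rules \<Omega>. head_preds (hd_of R) \<inter> ins \<Omega> = {})"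

definition pub_preds :: "'s io_prog \<Rightarrow> 's psym set" where
  "pub_preds \<Omega> = ins \<Omega> \<union> outs \<Omega>"

definition priv_preds :: "'s io_prog \<Rightarrow> 's psym set" where
  "priv_preds \<Omega> = program_preds (rules \<Omega>) - pub_preds \<Omega>"

definition comparable :: "'s io_prog \<Rightarrow> 's io_prog \<Rightarrow> bool" where
  "comparable \<Omega> \<Omega>' \<longleftrightarrow>
     placeholders \<Omega> = placeholders \<Omega>' \<and> ins \<Omega> = ins \<Omega>' \<and> outs \<Omega> = outs \<Omega>'"

text \<open>A valuation is a total function whose values outside of the set of placeholders are
  never used.\<close>

definition valuation_on :: "'s set \<Rightarrow> ('s \<Rightarrow> 's pterm) \<Rightarrow> bool" where
  "valuation_on PH v \<longleftrightarrow> (\<forall>c\<in>PH. v c \<notin> Sym ` PH)"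

text \<open>Instances of rules and standard interpretations (below) range over all precomputed terms,
  including the symbolic constants that serve as placeholders.  Accordingly, inputs and the
  vertices of the positive dependency graph are not required to avoid these constants: if they
  were, an assumption such as \<open>\<forall>X q(X)\<close> would be satisfied by standard interpretations but by no
  input, and a rule such as \<open>p(X) \<leftarrow> p(X), not q(X)\<close> could be locally tight although its
  completion does not determine \<open>p\<close> at a placeholder.\<close>

definition is_input :: "'s io_prog \<Rightarrow> ('s \<Rightarrow> 's pterm) \<Rightarrow> 's patom set \<Rightarrow> bool" where
  "is_input \<Omega> v I \<longleftrightarrow> valuation_on (placeholders \<Omega>) v \<and> (\<forall>a\<in>I. pred_of a \<in> ins \<Omega>)"

definition io_model ::
    "('s pterm \<Rightarrow> 's pterm \<Rightarrow> bool) \<Rightarrow> 's io_prog \<Rightarrow> ('s \<Rightarrow> 's pterm) \<Rightarrow> 's patom set \<Rightarrow>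
     's patom set \<Rightarrow> bool" where
  "io_model lt \<Omega> v I J \<longleftrightarrow>
     (\<exists>X. stable_model lt (val_program (placeholders \<Omega>) v (rules \<Omega>) \<union> fact_rule ` I) X \<and>
          J = {a \<in> X. pred_of a \<in> pub_preds \<Omega>})"

definition dep_vertex :: "'s io_prog \<Rightarrow> 's patom \<Rightarrow> bool" where
  "dep_vertex \<Omega> a \<longleftrightarrow> pred_of a \<in> outs \<Omega> \<union> priv_preds \<Omega>"

definition dep_edge ::
    "('s pterm \<Rightarrow> 's pterm \<Rightarrow> bool) \<Rightarrow> 's io_prog \<Rightarrow> ('s \<Rightarrow> 's pterm) \<Rightarrow> 's patom set \<Rightarrow>
     's patom \<Rightarrow> 's patom \<Rightarrow> bool" where
  "dep_edge lt \<Omega> v I a b \<longleftrightarrow>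
     dep_vertex \<Omega> a \<and> dep_vertex \<Omega> b \<and>
     (\<exists>R \<in> instances (val_program (placeholders \<Omega>) v (rules \<Omega>)).
        (\<exists>ts. (hd_of R = Basic (fst a) ts \<or> hd_of R = Choice (fst a) ts) \<and>
              snd a \<in> tuple_vals ts) \<and>
        (\<exists>ts. Pos (fst b) ts \<in> set (body_of R) \<and> snd b \<in> tuple_vals ts) \<and>
        (\<forall>q ts. (q, length ts) \<in> ins \<Omega> \<and>
              (Pos q ts \<in> set (body_of R) \<or> NafNaf q ts \<in> set (body_of R)) \<longrightarrow>
           (\<exists>r \<in> tuple_vals ts. (q, r) \<in> I)) \<and>
        (\<forall>q ts. (q, length ts) \<in> ins \<Omega> \<and> Naf q ts \<in> set (body_of R) \<longrightarrow>
           (\<exists>r \<in> tuple_vals ts. (q, r) \<notin> I)) \<and>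
        (\<forall>c t u. Comp c t u \<in> set (body_of R) \<longrightarrow>
           (\<exists>r\<in>vals t. \<exists>s\<in>vals u. rel_holds lt c r s)))"

definition locally_tight ::
    "('s pterm \<Rightarrow> 's pterm \<Rightarrow> bool) \<Rightarrow> 's io_prog \<Rightarrow> ('s \<Rightarrow> 's pterm) \<Rightarrow> 's patom set \<Rightarrow> bool" where
  "locally_tight lt \<Omega> v I \<longleftrightarrow> \<not> (\<exists>w. \<forall>i::nat. dep_edge lt \<Omega> v I (w i) (w (Suc i)))"

section \<open>Two-sorted formulas\<close>

text \<open>Terms of sort integer and of sort general are kept apart as types; \<open>GInt\<close> is the subsort
  inclusion.  Program variables are the general variables \<open>GV\<close>.\<close>

datatype itm = INum int | IVar nat | IAbs itm | IOp aop itm itm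
datatype 's gtm = GSym 's | GVar nat | GInt itm
datatype fvar = GV nat | IV nat

text \<open>\<open>FPred\<close> applies a predicate constant \<open>p/n\<close> and \<open>FPVar\<close> a predicate variable; as in atoms,
  \<open>n\<close> is the number of arguments.  \<open>FPEx (p, n)\<close> quantifies over the predicate variable \<open>p\<close> of
  arity \<open>n\<close>.  \<open>FRel EQ\<close> is the equality of the logic, and the other relations are the comparison
  symbols.\<close>

datatype 's fm =
    FPred 's "'s gtm list"
  | FPVar 's "'s gtm list"
  | FRel rel "'s gtm" "'s gtm"
  | FBot
  | FAnd "'s fm" "'s fm"
  | FOr "'s fm" "'s fm"
  | FImp "'s fm" "'s fm"
  | FAll fvar "'s fm"
  | FEx fvar "'s fm"
  | FPEx "'s psym" "'s fm"

definition FNot :: "'s fm \<Rightarrow> 's fm" where "FNot F = FImp F FBot"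
definition FTop :: "'s fm" where "FTop = FImp FBot FBot"
definition FIff :: "'s fm \<Rightarrow> 's fm \<Rightarrow> 's fm" where "FIff F G = FAnd (FImp F G) (FImp G F)"
definition FConj :: "'s fm list \<Rightarrow> 's fm" where "FConj Fs = foldr FAnd Fs FTop"
definition FDisj :: "'s fm list \<Rightarrow> 's fm" where "FDisj Fs = foldr FOr Fs FBot"
definition FAlls :: "fvar list \<Rightarrow> 's fm \<Rightarrow> 's fm" where "FAlls xs F = foldr FAll xs F"
definition FExs :: "fvar list \<Rightarrow> 's fm \<Rightarrow> 's fm" where "FExs xs F = foldr FEx xs F"
definition FPExs :: "'s psym list \<Rightarrow> 's fm \<Rightarrow> 's fm" where "FPExs ps F = foldr FPEx ps F"

primrec itm_fv :: "itm \<Rightarrow> fvar set" where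
  "itm_fv (INum n) = {}"
| "itm_fv (IVar i) = {IV i}"
| "itm_fv (IAbs t) = itm_fv t"
| "itm_fv (IOp f t u) = itm_fv t \<union> itm_fv u"

primrec gtm_fv :: "'s gtm \<Rightarrow> fvar set" where
  "gtm_fv (GSym c) = {}"
| "gtm_fv (GVar x) = {GV x}"
| "gtm_fv (GInt t) = itm_fv t"

primrec fv :: "'s fm \<Rightarrow> fvar set" where
  "fv (FPred p ts) = (\<Union>t\<in>set ts. gtm_fv t)"
| "fv (FPVar p ts) = (\<Union>t\<in>set ts. gtm_fv t)"
| "fv (FRel c t u) = gtm_fv t \<union> gtm_fv u"
| "fv FBot = {}"
| "fv (FAnd F G) = fv F \<union> fv G"
| "fv (FOr F G) = fv F \<union> fv G"
| "fv (FImp F G) = fv F \<union> fv G"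
| "fv (FAll x F) = fv F - {x}"
| "fv (FEx x F) = fv F - {x}"
| "fv (FPEx P F) = fv F"

primrec preds :: "'s fm \<Rightarrow> 's psym set" where
  "preds (FPred p ts) = {(p, length ts)}"
| "preds (FPVar p ts) = {}"
| "preds (FRel c t u) = {}"
| "preds FBot = {}"
| "preds (FAnd F G) = preds F \<union> preds G"
| "preds (FOr F G) = preds F \<union> preds G"
| "preds (FImp F G) = preds F \<union> preds G"
| "preds (FAll x F) = preds F"
| "preds (FEx x F) = preds F"
| "preds (FPEx P F) = preds F"

primrec first_order :: "'s fm \<Rightarrow> bool" where
  "first_order (FPred p ts) \<longleftrightarrow> True"
| "first_order (FPVar p ts) \<longleftrightarrow> False"
| "first_order (FRel c t u) \<longleftrightarrow> True"
| "first_order FBot \<longleftrightarrow> True"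
| "first_order (FAnd F G) \<longleftrightarrow> first_order F \<and> first_order G"
| "first_order (FOr F G) \<longleftrightarrow> first_order F \<and> first_order G"
| "first_order (FImp F G) \<longleftrightarrow> first_order F \<and> first_order G"
| "first_order (FAll x F) \<longleftrightarrow> first_order F"
| "first_order (FEx x F) \<longleftrightarrow> first_order F"
| "first_order (FPEx P F) \<longleftrightarrow> False"

definition uclosure :: "'s fm \<Rightarrow> 's fm" where
  "uclosure F = FAlls (listing (fv F)) F"

subsection \<open>Interpretations\<close>

record ('s, 'd) interp =
  gdom :: "'d set"
  idom :: "'d set"
  cst :: "'s pterm \<Rightarrow> 'd"
  absf :: "'d \<Rightarrow> 'd"
  opf :: "aop \<Rightarrow> 'd \<Rightarrow> 'd \<Rightarrow> 'd"
  relf :: "rel \<Rightarrow> 'd \<Rightarrow> 'd \<Rightarrow> bool"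
  prd :: "'s \<Rightarrow> 'd list \<Rightarrow> bool"

primrec itm_val :: "('s, 'd) interp \<Rightarrow> (fvar \<Rightarrow> 'd) \<Rightarrow> itm \<Rightarrow> 'd" where
  "itm_val M e (INum n) = cst M (Num n)"
| "itm_val M e (IVar i) = e (IV i)"
| "itm_val M e (IAbs t) = absf M (itm_val M e t)"
| "itm_val M e (IOp f t u) = opf M f (itm_val M e t) (itm_val M e u)"

primrec gtm_val :: "('s, 'd) interp \<Rightarrow> (fvar \<Rightarrow> 'd) \<Rightarrow> 's gtm \<Rightarrow> 'd" where
  "gtm_val M e (GSym c) = cst M (Sym c)"
| "gtm_val M e (GVar x) = e (GV x)"
| "gtm_val M e (GInt t) = itm_val M e t"

fun sort_dom :: "('s, 'd) interp \<Rightarrow> fvar \<Rightarrow> 'd set" where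
  "sort_dom M (GV x) = gdom M"
| "sort_dom M (IV i) = idom M"

primrec sat ::
    "('s, 'd) interp \<Rightarrow> (fvar \<Rightarrow> 'd) \<Rightarrow> ('s psym \<Rightarrow> 'd list set) \<Rightarrow> 's fm \<Rightarrow> bool" where
  "sat M e E (FPred p ts) \<longleftrightarrow> prd M p (map (gtm_val M e) ts)"
| "sat M e E (FPVar p ts) \<longleftrightarrow> map (gtm_val M e) ts \<in> E (p, length ts)"
| "sat M e E (FRel c t u) \<longleftrightarrow>
     (if c = EQ then gtm_val M e t = gtm_val M e u
      else relf M c (gtm_val M e t) (gtm_val M e u))"
| "sat M e E FBot \<longleftrightarrow> False"
| "sat M e E (FAnd F G) \<longleftrightarrow> sat M e E F \<and> sat M e E G"
| "sat M e E (FOr F G) \<longleftrightarrow> sat M e E F \<or> sat M e E G"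
| "sat M e E (FImp F G) \<longleftrightarrow> (sat M e E F \<longrightarrow> sat M e E G)"
| "sat M e E (FAll x F) \<longleftrightarrow> (\<forall>d \<in> sort_dom M x. sat M (e(x := d)) E F)"
| "sat M e E (FEx x F) \<longleftrightarrow> (\<exists>d \<in> sort_dom M x. sat M (e(x := d)) E F)"
| "sat M e E (FPEx P F) \<longleftrightarrow>
     (\<exists>S \<subseteq> {ds. length ds = snd P \<and> set ds \<subseteq> gdom M}. sat M e (E(P := S)) F)"

text \<open>Used for sentences only, whose truth does not depend on the assignments.\<close>

definition models :: "('s, 'd) interp \<Rightarrow> 's fm \<Rightarrow> bool" where
  "models M F \<longleftrightarrow> (\<forall>e E. sat M e E F)"

definition standard_for ::
    "('s pterm \<Rightarrow> 's pterm \<Rightarrow> bool) \<Rightarrow> 's set \<Rightarrow> ('s, 's pterm) interp \<Rightarrow> bool" where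
  "standard_for lt PH M \<longleftrightarrow>
     gdom M = UNIV \<and> idom M = range Num \<and>
     (\<forall>n. cst M (Num n) = Num n) \<and>
     (\<forall>c\<in>PH. cst M (Sym c) \<notin> Sym ` PH) \<and>
     (\<forall>c. c \<notin> PH \<longrightarrow> cst M (Sym c) = Sym c) \<and>
     (\<forall>n. absf M (Num n) = Num \<bar>n\<bar>) \<and>
     (\<forall>f m n. opf M f (Num m) (Num n) = Num (arith f m n)) \<and>
     (\<forall>c r s. c \<noteq> EQ \<longrightarrow> relf M c r s = rel_holds lt c r s)"

definition interp_of ::
    "('s pterm \<Rightarrow> 's pterm \<Rightarrow> bool) \<Rightarrow> 's set \<Rightarrow> ('s \<Rightarrow> 's pterm) \<Rightarrow> 's patom set \<Rightarrow>
     ('s, 's pterm) interp" where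
  "interp_of lt PH v J =
     \<lparr> gdom = UNIV, idom = range Num, cst = apply_val PH v,
       absf = (\<lambda>r. Num \<bar>the_int r\<bar>),
       opf = (\<lambda>f r s. Num (arith f (the_int r) (the_int s))),
       relf = rel_holds lt,
       prd = (\<lambda>p rs. (p, rs) \<in> J) \<rparr>"

lemma standard_for_interp_of:
  "valuation_on PH v \<Longrightarrow> standard_for lt PH (interp_of lt PH v J)"
  by (auto simp: standard_for_def interp_of_def valuation_on_def apply_val_def)

subsection \<open>Assumptions\<close>

definition assumption_for :: "'s io_prog \<Rightarrow> 's fm \<Rightarrow> bool" where
  "assumption_for \<Omega> A \<longleftrightarrow> first_order A \<and> fv A = {} \<and> preds A \<subseteq> ins \<Omega>"

definition in_domain ::
    "('s pterm \<Rightarrow> 's pterm \<Rightarrow> bool) \<Rightarrow> 's io_prog \<Rightarrow> 's fm \<Rightarrow> ('s \<Rightarrow> 's pterm) \<Rightarrow> 's patom set \<Rightarrow>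
     bool" where
  "in_domain lt \<Omega> A v I \<longleftrightarrow> is_input \<Omega> v I \<and> models (interp_of lt (placeholders \<Omega>) v I) A"

definition locally_tight_under ::
    "('s pterm \<Rightarrow> 's pterm \<Rightarrow> bool) \<Rightarrow> 's io_prog \<Rightarrow> 's fm \<Rightarrow> bool" where
  "locally_tight_under lt \<Omega> A \<longleftrightarrow> (\<forall>v I. in_domain lt \<Omega> A v I \<longrightarrow> locally_tight lt \<Omega> v I)"

definition equivalent_under ::
    "('s pterm \<Rightarrow> 's pterm \<Rightarrow> bool) \<Rightarrow> 's io_prog \<Rightarrow> 's io_prog \<Rightarrow> 's fm \<Rightarrow> bool" where
  "equivalent_under lt \<Omega> \<Omega>' A \<longleftrightarrow>
     (\<forall>v I. in_domain lt \<Omega> A v I \<longrightarrow> (\<forall>J. io_model lt \<Omega> v I J \<longleftrightarrow> io_model lt \<Omega>' v I J))"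

section \<open>The translation \<open>\<tau>\<^sup>*\<close>\<close>

primrec const_gtm :: "'s pterm \<Rightarrow> 's gtm" where
  "const_gtm (Num n) = GInt (INum n)"
| "const_gtm (Sym c) = GSym c"

primrec var_gtm :: "fvar \<Rightarrow> 's gtm" where
  "var_gtm (GV x) = GVar x"
| "var_gtm (IV i) = GInt (IVar i)"

text \<open>The only free variables of \<open>valf t V\<close> are \<open>V\<close> and the (general) variables of \<open>t\<close>, so that
  the bound integer variables only need to differ from \<open>V\<close> and from each other.\<close>

fun fresh_int :: "fvar \<Rightarrow> nat" where
  "fresh_int (GV x) = 0"
| "fresh_int (IV i) = Suc i"

text \<open>\<open>quot I J K\<close> is \<open>K \<times> |J| \<le> |I| < (K + 1) \<times> |J|\<close>, and \<open>-K\<close> is rendered as \<open>0 - K\<close>.\<close>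

definition quot :: "itm \<Rightarrow> itm \<Rightarrow> itm \<Rightarrow> 's fm" where
  "quot I J K = FAnd
     (FRel LE (GInt (IOp Times K (IAbs J))) (GInt (IAbs I)))
     (FRel LT (GInt (IAbs I)) (GInt (IOp Times (IOp Plus K (INum 1)) (IAbs J))))"

definition by_sign :: "itm \<Rightarrow> itm \<Rightarrow> 's gtm \<Rightarrow> itm \<Rightarrow> itm \<Rightarrow> 's fm" where
  "by_sign I J V S T = FOr
     (FAnd (FRel GE (GInt (IOp Times I J)) (GInt (INum 0))) (FRel EQ V (GInt S)))
     (FAnd (FRel LT (GInt (IOp Times I J)) (GInt (INum 0))) (FRel EQ V (GInt T)))"

fun binop_fm :: "binop \<Rightarrow> nat \<Rightarrow> nat \<Rightarrow> nat \<Rightarrow> 's gtm \<Rightarrow> 's fm" where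
  "binop_fm (Arith f) i j k V = FRel EQ V (GInt (IOp f (IVar i) (IVar j)))"
| "binop_fm Div i j k V =
     FEx (IV k) (FAnd (quot (IVar i) (IVar j) (IVar k))
       (by_sign (IVar i) (IVar j) V (IVar k) (IOp Minus (INum 0) (IVar k))))"
| "binop_fm Mod i j k V =
     FEx (IV k) (FAnd (quot (IVar i) (IVar j) (IVar k))
       (by_sign (IVar i) (IVar j) V
          (IOp Minus (IVar i) (IOp Times (IVar k) (IVar j)))
          (IOp Plus (IVar i) (IOp Times (IVar k) (IVar j)))))"
| "binop_fm Interval i j k V =
     FEx (IV k) (FAnd
       (FAnd (FRel LE (GInt (IVar i)) (GInt (IVar k))) (FRel LE (GInt (IVar k)) (GInt (IVar j))))
       (FRel EQ V (GInt (IVar k))))"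

primrec valf :: "'s tm \<Rightarrow> fvar \<Rightarrow> 's fm" where
  "valf (Pre r) V = FRel EQ (var_gtm V) (const_gtm r)"
| "valf (Var x) V = FRel EQ (var_gtm V) (GVar x)"
| "valf (TAbs t) V = (let i = fresh_int V in
     FEx (IV i) (FAnd (valf t (IV i)) (FRel EQ (var_gtm V) (GInt (IAbs (IVar i))))))"
| "valf (Bin f t u) V = (let i = fresh_int V; j = i + 1; k = i + 2 in
     FEx (IV i) (FEx (IV j) (FAnd (FAnd (valf t (IV i)) (valf u (IV j)))
       (binop_fm f i j k (var_gtm V)))))"

definition valf_tuple :: "'s tm list \<Rightarrow> nat list \<Rightarrow> 's fm" where
  "valf_tuple ts Vs = FConj (map2 valf ts (map GV Vs))"

text \<open>The first \<open>n\<close> general variables not in \<open>X\<close>, where \<open>X\<close> will be the set of variables of the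
  program.  They are used in the heads and, bound, in the bodies of rules.\<close>

definition new_vars :: "nat set \<Rightarrow> nat \<Rightarrow> nat list" where
  "new_vars X n = map (enumerate (- X)) [0..<n]"

definition pred_fm :: "'s \<Rightarrow> nat list \<Rightarrow> 's fm" where
  "pred_fm p Vs = FPred p (map GVar Vs)"

primrec tauB_blit :: "nat set \<Rightarrow> 's blit \<Rightarrow> 's fm" where
  "tauB_blit X (Pos p ts) = (let Vs = new_vars X (length ts) in
     FExs (map GV Vs) (FAnd (valf_tuple ts Vs) (pred_fm p Vs)))"
| "tauB_blit X (Naf p ts) = (let Vs = new_vars X (length ts) in
     FExs (map GV Vs) (FAnd (valf_tuple ts Vs) (FNot (pred_fm p Vs))))"
| "tauB_blit X (NafNaf p ts) = (let Vs = new_vars X (length ts) in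
     FExs (map GV Vs) (FAnd (valf_tuple ts Vs) (FNot (FNot (pred_fm p Vs)))))"
| "tauB_blit X (Comp c t u) = (let Vs = new_vars X 2 in
     FExs (map GV Vs) (FAnd (valf_tuple [t, u] Vs) (FRel c (GVar (Vs ! 0)) (GVar (Vs ! 1)))))"

definition tauB :: "nat set \<Rightarrow> 's blit list \<Rightarrow> 's fm" where
  "tauB X B = FConj (map (tauB_blit X) B)"

definition tau_star_rule :: "nat set \<Rightarrow> 's rule \<Rightarrow> 's fm" where
  "tau_star_rule X R = uclosure
     (case hd_of R of
        Basic p ts \<Rightarrow> (let Vs = new_vars X (length ts) in
          FImp (FAnd (valf_tuple ts Vs) (tauB X (body_of R))) (pred_fm p Vs))
      | Choice p ts \<Rightarrow> (let Vs = new_vars X (length ts) in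
          FImp (FAnd (FAnd (valf_tuple ts Vs) (tauB X (body_of R))) (FNot (FNot (pred_fm p Vs))))
               (pred_fm p Vs))
      | Constraint \<Rightarrow> FImp (tauB X (body_of R)) FBot)"

definition tau_star :: "'s rule set \<Rightarrow> 's fm set" where
  "tau_star \<Pi> = tau_star_rule (program_vars \<Pi>) ` \<Pi>"

section \<open>Completion\<close>

text \<open>\<open>\<Gamma>\<close> is a finite set of sentences of the form \<open>uclosure (FImp F G)\<close>; \<open>F\<close> and \<open>G\<close> are
  determined by the sentence.  For an intensional symbol \<open>p/n\<close>, \<open>Vs n\<close> is the tuple of variables
  in the consequents of its defining members.\<close>

definition completed_def :: "(nat \<Rightarrow> nat list) \<Rightarrow> 's fm set \<Rightarrow> 's psym \<Rightarrow> 's fm" where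
  "completed_def Vs \<Gamma> P = (let V = Vs (snd P); G = pred_fm (fst P) V in
     FAlls (map GV V) (FIff G
       (FDisj (map (\<lambda>F. FExs (listing (fv F - GV ` set V)) F)
                 (listing {F. uclosure (FImp F G) \<in> \<Gamma>})))))"

definition completion_fm :: "(nat \<Rightarrow> nat list) \<Rightarrow> 's psym set \<Rightarrow> 's fm set \<Rightarrow> 's fm" where
  "completion_fm Vs intens \<Gamma> =
     FConj (map (completed_def Vs \<Gamma>) (listing intens) @
            listing {S \<in> \<Gamma>. \<exists>F G. S = uclosure (FImp F G) \<and> preds G \<inter> intens = {}})"

text \<open>A private symbol \<open>p/n\<close> is replaced by the predicate variable with the same name and
  arity.\<close>

primrec preds_to_vars :: "'s psym set \<Rightarrow> 's fm \<Rightarrow> 's fm" where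
  "preds_to_vars Q (FPred p ts) = (if (p, length ts) \<in> Q then FPVar p ts else FPred p ts)"
| "preds_to_vars Q (FPVar p ts) = FPVar p ts"
| "preds_to_vars Q (FRel c t u) = FRel c t u"
| "preds_to_vars Q FBot = FBot"
| "preds_to_vars Q (FAnd F G) = FAnd (preds_to_vars Q F) (preds_to_vars Q G)"
| "preds_to_vars Q (FOr F G) = FOr (preds_to_vars Q F) (preds_to_vars Q G)"
| "preds_to_vars Q (FImp F G) = FImp (preds_to_vars Q F) (preds_to_vars Q G)"
| "preds_to_vars Q (FAll x F) = FAll x (preds_to_vars Q F)"
| "preds_to_vars Q (FEx x F) = FEx x (preds_to_vars Q F)"
| "preds_to_vars Q (FPEx P F) = FPEx P (preds_to_vars Q F)"

definition completion :: "'s io_prog \<Rightarrow> 's fm" where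
  "completion \<Omega> = FPExs (listing (priv_preds \<Omega>)) (preds_to_vars (priv_preds \<Omega>)
     (completion_fm (new_vars (program_vars (rules \<Omega>))) (outs \<Omega> \<union> priv_preds \<Omega>) (tau_star (rules \<Omega>))))"

end

theory Submission
  imports Defs
begin

text \<open>In a standard interpretation, the formula \<open>val\<^sub>t(V)\<close> says that \<open>V\<close> is a value of the ground
  instance of \<open>t\<close>.  Hence the completion of \<open>\<tau>\<^sup>*\<Pi>\<close> says that the set of true atoms satisfies the
  ground constraints and contains an intensional atom exactly if it is supported by a ground
  instance of a rule.  Stable models always have this property; conversely, if \<open>X\<close> has it and
  the reduct had a model \<open>Y \<subset> X\<close>, then every rule supporting an atom of \<open>X - Y\<close> would have a
  positive body atom in \<open>X - Y\<close>, which yields an infinite walk in the positive dependency graph.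
  So under local tightness a standard interpretation satisfies \<open>comp[\<Omega>]\<close> iff its public atoms
  form an io-model of \<open>\<Omega>\<close>; the quantified predicate variables range over the private parts of
  the stable models.\<close>

section \<open>Satisfaction of first-order formulas\<close>

lemma sat_connectives [simp]:
  "sat M e E (FNot F) \<longleftrightarrow> \<not> sat M e E F"
  "sat M e E (FIff F G) \<longleftrightarrow> (sat M e E F \<longleftrightarrow> sat M e E G)"
  by (auto simp: FNot_def FIff_def)

lemma sat_FConj [simp]: "sat M e E (FConj Fs) \<longleftrightarrow> (\<forall>F\<in>set Fs. sat M e E F)"
  unfolding FConj_def by (induction Fs) (auto simp: FTop_def)

lemma sat_FDisj [simp]: "sat M e E (FDisj Fs) \<longleftrightarrow> (\<exists>F\<in>set Fs. sat M e E F)"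
  unfolding FDisj_def by (induction Fs) auto

text \<open>A whole block of quantifiers amounts to one choice of an assignment. The variables may
  repeat: the innermost quantifier then decides, so neither distinctness nor the order of the
  enumeration matters.\<close>

lemma sat_FExs:
  "sat M e E (FExs xs F) \<longleftrightarrow>
     (\<exists>e'. (\<forall>x. x \<notin> set xs \<longrightarrow> e' x = e x) \<and> (\<forall>x\<in>set xs. e' x \<in> sort_dom M x) \<and> sat M e' E F)"
proof (induction xs arbitrary: e)
  case Nil
  have "(\<forall>x. e' x = e x) \<longleftrightarrow> e' = e" for e' by auto
  then show ?case by (simp add: FExs_def)
next
  case (Cons x xs)
  have "sat M e E (FExs (x # xs) F) \<longleftrightarrow> (\<exists>d\<in>sort_dom M x. sat M (e(x := d)) E (FExs xs F))"
    by (simp add: FExs_def)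
  also have "\<dots> \<longleftrightarrow> (\<exists>e'. (\<forall>y. y \<notin> set (x # xs) \<longrightarrow> e' y = e y) \<and>
      (\<forall>y\<in>set (x # xs). e' y \<in> sort_dom M y) \<and> sat M e' E F)" (is "?L \<longleftrightarrow> ?R")
  proof
    assume ?L
    then obtain d e' where "d \<in> sort_dom M x" "\<forall>y. y \<notin> set xs \<longrightarrow> e' y = (e(x := d)) y"
      "\<forall>y\<in>set xs. e' y \<in> sort_dom M y" "sat M e' E F"
      unfolding Cons.IH by auto
    then show ?R by (intro exI[of _ e']) (cases "x \<in> set xs", auto)
  next
    assume ?R
    then obtain e' where e': "\<forall>y. y \<notin> set (x # xs) \<longrightarrow> e' y = e y"
      "\<forall>y\<in>set (x # xs). e' y \<in> sort_dom M y" "sat M e' E F" by blast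
    then have "sat M (e(x := e' x)) E (FExs xs F)"
      unfolding Cons.IH by (intro exI[of _ e']) auto
    with e' show ?L by auto
  qed
  finally show ?case .
qed

lemma sat_FAlls:
  "sat M e E (FAlls xs F) \<longleftrightarrow>
     (\<forall>e'. (\<forall>x. x \<notin> set xs \<longrightarrow> e' x = e x) \<and> (\<forall>x\<in>set xs. e' x \<in> sort_dom M x) \<longrightarrow>
        sat M e' E F)"
proof -
  have "sat M e E (FAlls xs F) \<longleftrightarrow> \<not> sat M e E (FExs xs (FNot F))"
    by (induction xs arbitrary: e) (auto simp: FAlls_def FExs_def)
  then show ?thesis by (simp add: sat_FExs) blast
qed

lemma sat_FPExs:
  "sat M e E (FPExs Ps F) \<longleftrightarrow>
     (\<exists>E'. (\<forall>P. P \<notin> set Ps \<longrightarrow> E' P = E P) \<and>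
        (\<forall>P\<in>set Ps. E' P \<subseteq> {ds. length ds = snd P \<and> set ds \<subseteq> gdom M}) \<and> sat M e E' F)"
proof (induction Ps arbitrary: E)
  case Nil
  have "(\<forall>P. E' P = E P) \<longleftrightarrow> E' = E" for E' by auto
  then show ?case by (simp add: FPExs_def)
next
  case (Cons Q Ps)
  let ?D = "\<lambda>P. {ds. length ds = snd P \<and> set ds \<subseteq> gdom M}"
  have "sat M e E (FPExs (Q # Ps) F) \<longleftrightarrow> (\<exists>S \<subseteq> ?D Q. sat M e (E(Q := S)) (FPExs Ps F))"
    by (simp add: FPExs_def)
  also have "\<dots> \<longleftrightarrow> (\<exists>E'. (\<forall>P. P \<notin> set (Q # Ps) \<longrightarrow> E' P = E P) \<and>
      (\<forall>P\<in>set (Q # Ps). E' P \<subseteq> ?D P) \<and> sat M e E' F)" (is "?L \<longleftrightarrow> ?R")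
  proof
    assume ?L
    then obtain S E' where S: "S \<subseteq> ?D Q" "\<forall>P. P \<notin> set Ps \<longrightarrow> E' P = (E(Q := S)) P"
      "\<forall>P\<in>set Ps. E' P \<subseteq> ?D P" "sat M e E' F"
      unfolding Cons.IH by blast
    \<comment> \<open>If \<open>Q\<close> is bound again further inside, the inner choice overrides
      \<open>S\<close>, and its arity bound comes from the induction hypothesis instead.\<close>
    then have "E' Q = S" if "Q \<notin> set Ps" using S(2)[rule_format, OF that] by simp
    with S(1,3) have "E' Q \<subseteq> ?D Q" by (cases "Q \<in> set Ps") blast+
    with S show ?R by (intro exI[of _ E']) auto
  next
    assume ?R
    then obtain E' where E': "\<forall>P. P \<notin> set (Q # Ps) \<longrightarrow> E' P = E P"
      "\<forall>P\<in>set (Q # Ps). E' P \<subseteq> ?D P" "sat M e E' F" by blast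
    then have "sat M e (E(Q := E' Q)) (FPExs Ps F)"
      unfolding Cons.IH by (intro exI[of _ E']) auto
    with E' show ?L by (intro exI[of _ "E' Q"]) auto
  qed
  finally show ?case .
qed

section \<open>Coincidence and closures\<close>

lemma itm_val_cong: "(\<And>x. x \<in> itm_fv t \<Longrightarrow> e x = e' x) \<Longrightarrow> itm_val M e t = itm_val M e' t"
  by (induction t) auto

lemma gtm_val_cong: "(\<And>x. x \<in> gtm_fv t \<Longrightarrow> e x = e' x) \<Longrightarrow> gtm_val M e t = gtm_val M e' t"
  by (cases t) (auto intro: itm_val_cong)

text \<open>Being first-order excludes predicate variables, which is why \<open>E\<close> and
  \<open>E'\<close> may be unrelated.\<close>

lemma sat_cong:
  assumes "first_order F" "\<And>x. x \<in> fv F \<Longrightarrow> e x = e' x"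
  shows "sat M e E F \<longleftrightarrow> sat M e' E' F"
  using assms
proof (induction F arbitrary: e e')
  case (FPred p ts)
  then have "map (gtm_val M e) ts = map (gtm_val M e') ts" by (auto intro!: gtm_val_cong)
  then show ?case by (simp only: sat.simps)
next
  case (FRel c t u)
  then have "gtm_val M e t = gtm_val M e' t" "gtm_val M e u = gtm_val M e' u"
    by (auto intro!: gtm_val_cong)
  then show ?case by simp
next
  case (FAnd F G)
  then show ?case using FAnd.IH[of e e'] by simp
next
  case (FOr F G)
  then show ?case using FOr.IH[of e e'] by simp
next
  case (FImp F G)
  then show ?case using FImp.IH[of e e'] by simp
next
  case (FAll x F)
  then have "sat M (e(x := d)) E F \<longleftrightarrow> sat M (e'(x := d)) E' F" for d by (intro FAll.IH) auto
  then show ?case by simp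
next
  case (FEx x F)
  then have "sat M (e(x := d)) E F \<longleftrightarrow> sat M (e'(x := d)) E' F" for d by (intro FEx.IH) auto
  then show ?case by simp
qed auto

lemma finite_fv [simp]: "finite (fv F)"
proof -
  have i: "finite (itm_fv t)" for t by (induction t) auto
  have g: "finite (gtm_fv t)" for t :: "'a gtm" by (cases t) (auto simp: i)
  show ?thesis by (induction F) (auto simp: g)
qed

text \<open>Values outside \<open>W\<close> and the free variables are irrelevant, so the
  requirement to agree with \<open>e\<close> can be relaxed to \<open>W\<close>. Witnesses can then
  be built without tracking which variables actually occur in \<open>F\<close>.\<close>

lemma sat_FExs_fv:
  assumes "first_order F"
  shows "sat M e E (FExs (listing (fv F - W)) F) \<longleftrightarrow>
    (\<exists>e'. (\<forall>x\<in>W. e' x = e x) \<and> (\<forall>x\<in>fv F - W. e' x \<in> sort_dom M x) \<and> sat M e' E F)"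
    (is "?L \<longleftrightarrow> ?R")
proof
  assume ?L
  then show ?R unfolding sat_FExs by (auto simp: listing)
next
  assume ?R
  then obtain e' where e': "\<forall>x\<in>W. e' x = e x" "\<forall>x\<in>fv F - W. e' x \<in> sort_dom M x" "sat M e' E F"
    by blast
  let ?e = "\<lambda>x. if x \<in> fv F - W then e' x else e x"
  have "sat M ?e E F \<longleftrightarrow> sat M e' E F"
    using e'(1) by (intro sat_cong[OF assms]) auto
  with e' show ?L unfolding sat_FExs by (intro exI[of _ ?e]) (auto simp: listing)
qed

lemma sat_uclosure:
  assumes "first_order F"
  shows "sat M e E (uclosure F) \<longleftrightarrow>
    (\<forall>e'. (\<forall>x\<in>fv F. e' x \<in> sort_dom M x) \<longrightarrow> sat M e' E F)" (is "?L \<longleftrightarrow> ?R")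
proof
  assume ?R
  then show ?L unfolding uclosure_def sat_FAlls by (auto simp: listing)
next
  assume L: ?L
  show ?R
  proof (intro allI impI)
    fix e' assume e': "\<forall>x\<in>fv F. e' x \<in> sort_dom M x"
    let ?e = "\<lambda>x. if x \<in> fv F then e' x else e x"
    have "sat M ?e E F" using L e' unfolding uclosure_def sat_FAlls by (auto simp: listing)
    moreover have "sat M ?e E F \<longleftrightarrow> sat M e' E F" by (intro sat_cong[OF assms]) auto
    ultimately show "sat M e' E F" by simp
  qed
qed

lemma ex_assignment:
  assumes "distinct Vs" "length rs = length Vs"
  obtains e' where "\<forall>x. x \<notin> GV ` set Vs \<longrightarrow> e' x = e x" "map (\<lambda>x. e' (GV x)) Vs = rs"
proof -
  have "\<exists>e'. (\<forall>x. x \<notin> GV ` set Vs \<longrightarrow> e' x = e x) \<and> map (\<lambda>x. e' (GV x)) Vs = rs"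
    using assms(2,1)
  proof (induction rs Vs rule: list_induct2)
    case (Cons r rs V Vs)
    then obtain e' where e': "\<forall>x. x \<notin> GV ` set Vs \<longrightarrow> e' x = e x" "map (\<lambda>x. e' (GV x)) Vs = rs"
      by auto
    with Cons(3) show ?case by (intro exI[of _ "e'(GV V := r)"]) auto
  qed auto
  with that show ?thesis by blast
qed

text \<open>Predicate variables are read as predicate constants of a modified interpretation. Thus
  the second-order quantifiers of the completion turn into a choice of extents for the private
  symbols, and only first-order formulas remain to be analysed.\<close>

lemma sat_preds_to_vars:
  assumes "first_order F"
  shows "sat M e E (preds_to_vars Q F) \<longleftrightarrow>
    sat (M\<lparr>prd := \<lambda>p ds. if (p, length ds) \<in> Q then ds \<in> E (p, length ds) else prd M p ds\<rparr>) e E F"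
    (is "_ \<longleftrightarrow> sat ?M e E F")
proof -
  have i: "itm_val ?M e t = itm_val M e t" for e t by (induction t) auto
  have g: "gtm_val ?M e t = gtm_val M e t" for e t by (cases t) (auto simp: i)
  have d: "sort_dom ?M x = sort_dom M x" for x by (cases x) auto
  show ?thesis using assms
    by (induction F arbitrary: e) (auto simp: g d cong: map_cong)
qed

lemma first_order_folds:
  "first_order (FConj Fs) \<longleftrightarrow> (\<forall>F\<in>set Fs. first_order F)"
  "first_order (FDisj Fs) \<longleftrightarrow> (\<forall>F\<in>set Fs. first_order F)"
  "first_order (FExs xs F) \<longleftrightarrow> first_order F"
  "first_order (FAlls xs F) \<longleftrightarrow> first_order F"
  "first_order (FNot F) \<longleftrightarrow> first_order F"
  "first_order (FIff F G) \<longleftrightarrow> first_order F \<and> first_order G"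
  "first_order (uclosure F) \<longleftrightarrow> first_order F"
proof -
  have a: "first_order (FAlls xs F) \<longleftrightarrow> first_order F" for xs
    unfolding FAlls_def by (induction xs) auto
  then show "first_order (FAlls xs F) \<longleftrightarrow> first_order F" .
  show "first_order (FConj Fs) \<longleftrightarrow> (\<forall>F\<in>set Fs. first_order F)"
    unfolding FConj_def by (induction Fs) (auto simp: FTop_def)
  show "first_order (FDisj Fs) \<longleftrightarrow> (\<forall>F\<in>set Fs. first_order F)"
    unfolding FDisj_def by (induction Fs) auto
  show "first_order (FExs xs F) \<longleftrightarrow> first_order F"
    unfolding FExs_def by (induction xs) auto
  show "first_order (uclosure F) \<longleftrightarrow> first_order F" by (simp add: uclosure_def a)
qed (auto simp: FNot_def FIff_def)

section \<open>Standard interpretations\<close>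

lemma new_vars:
  assumes "finite X"
  shows "length (new_vars X n) = n" "distinct (new_vars X n)" "set (new_vars X n) \<inter> X = {}"
proof -
  have inf: "infinite (- X)" using assms by simp
  show "length (new_vars X n) = n" by (simp add: new_vars_def)
  show "distinct (new_vars X n)"
    by (simp add: new_vars_def distinct_map inj_on_def enumerate_step
        strict_mono_eq[OF strict_mono_enumerate[OF inf]])
  show "set (new_vars X n) \<inter> X = {}"
    using enumerate_in_set[OF inf] by (auto simp: new_vars_def)
qed

lemma tuple_vals_Nil [simp]: "rs \<in> tuple_vals [] \<longleftrightarrow> rs = []"
  by (simp add: tuple_vals_def)

lemma tuple_vals_Cons [simp]:
  "r # rs \<in> tuple_vals (t # ts) \<longleftrightarrow> r \<in> vals t \<and> rs \<in> tuple_vals ts"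
  by (simp add: tuple_vals_def set_Cons_def)

lemma tuple_vals_length: "rs \<in> tuple_vals ts \<Longrightarrow> length rs = length ts"
  by (induction ts arbitrary: rs) (auto simp: tuple_vals_def set_Cons_def)

lemma subst_tm_cong: "(\<And>x. x \<in> tm_vars t \<Longrightarrow> \<sigma> x = \<sigma>' x) \<Longrightarrow> subst_tm \<sigma> t = subst_tm \<sigma>' t"
  by (induction t) auto

lemma tm_vars_val_tm [simp]: "tm_vars (val_tm PH v t) = tm_vars t"
  by (induction t) auto

text \<open>This is the meaning of \<open>quot\<close>. For \<open>n = 0\<close> the bounds would
  give \<open>\<bar>m\<bar> < 0\<close>, so the formula itself excludes division by zero.\<close>

lemma quotient_bounds_iff:
  fixes k m n :: int
  shows "k * \<bar>n\<bar> \<le> \<bar>m\<bar> \<and> \<bar>m\<bar> < (k + 1) * \<bar>n\<bar> \<longleftrightarrow> n \<noteq> 0 \<and> k = \<bar>m\<bar> div \<bar>n\<bar>"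
proof (cases "n = 0")
  case False
  define a b where "a = \<bar>m\<bar>" and "b = \<bar>n\<bar>"
  have b: "b > 0" using False by (simp add: b_def)
  have "k = a div b" if "k * b \<le> a" "a < (k + 1) * b"
    \<comment> \<open>The bounds say precisely that \<open>a - k * b\<close> is a legitimate
      remainder modulo \<open>b\<close>.\<close>
    using that by (intro int_div_pos_eq[of _ _ _ "a - k * b", symmetric]) (auto simp: algebra_simps)
  moreover have "(a div b) * b \<le> a" "a < (a div b + 1) * b"
    using pos_mod_bound[OF b, of a] pos_mod_sign[OF b, of a] div_mult_mod_eq[of a b]
    unfolding distrib_right mult_1 by linarith+
  ultimately show ?thesis using False unfolding a_def b_def by blast
qed simp

text \<open>Truncation toward zero is the floor of the absolute value with the sign put back, and
  the quotient has the sign of \<open>m * n\<close>. This matches the case distinction in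
  \<open>by_sign\<close>.\<close>

lemma round0_divide:
  "round0 (of_int m / of_int n) = (if m * n \<ge> 0 then \<bar>m\<bar> div \<bar>n\<bar> else - (\<bar>m\<bar> div \<bar>n\<bar>))"
proof -
  define q :: rat where "q = of_int m / of_int n"
  have f: "\<lfloor>\<bar>q\<bar>\<rfloor> = \<bar>m\<bar> div \<bar>n\<bar>"
    unfolding q_def by (metis abs_divide floor_divide_of_int_eq of_int_abs)
  have s: "q \<ge> 0 \<longleftrightarrow> m * n \<ge> 0"
    unfolding q_def by (simp add: zero_le_divide_iff zero_le_mult_iff)
  have "round0 q = (if q \<ge> 0 then \<lfloor>\<bar>q\<bar>\<rfloor> else - \<lfloor>\<bar>q\<bar>\<rfloor>)"
    by (simp add: round0_def ceiling_def)
  then show ?thesis unfolding f s by (simp only: q_def)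
qed

lemma psat_connectives [simp]:
  "psat X (PNot F) \<longleftrightarrow> \<not> psat X F"
  "psat X (PConj Fs) \<longleftrightarrow> (\<forall>F\<in>set Fs. psat X F)"
  "psat X (PDisj Fs) \<longleftrightarrow> (\<exists>F\<in>set Fs. psat X F)"
proof -
  show "psat X (PConj Fs) \<longleftrightarrow> (\<forall>F\<in>set Fs. psat X F)"
    unfolding PConj_def by (induction Fs) (auto simp: PTop_def)
  show "psat X (PDisj Fs) \<longleftrightarrow> (\<exists>F\<in>set Fs. psat X F)"
    unfolding PDisj_def by (induction Fs) auto
qed (simp add: PNot_def)

text \<open>The quantifier stays existential under negation: a negated atom holds as soon as one of
  its values is missing from \<open>X\<close>.\<close>

lemma psat_tau_blit:
  "psat X (tau_blit lt (Pos p ts)) \<longleftrightarrow> (\<exists>r\<in>tuple_vals ts. (p, r) \<in> X)"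
  "psat X (tau_blit lt (Naf p ts)) \<longleftrightarrow> (\<exists>r\<in>tuple_vals ts. (p, r) \<notin> X)"
  "psat X (tau_blit lt (NafNaf p ts)) \<longleftrightarrow> (\<exists>r\<in>tuple_vals ts. (p, r) \<in> X)"
  "psat X (tau_blit lt (Comp c t u)) \<longleftrightarrow> (\<exists>r\<in>vals t. \<exists>s\<in>vals u. rel_holds lt c r s)"
  by (auto simp: listing finite_tuple_vals PTop_def)

lemma psat_tau_body: "psat X (tau_body lt B) \<longleftrightarrow> (\<forall>l\<in>set B. psat X (tau_blit lt l))"
  by (simp add: tau_body_def)

text \<open>For a choice rule, the condition \<open>a \<in> X\<close> comes from the conjunct \<open>\<not>\<not>p(V)\<close> in its
  translation.\<close>

definition supports ::
    "('s pterm \<Rightarrow> 's pterm \<Rightarrow> bool) \<Rightarrow> 's patom set \<Rightarrow> 's rule \<Rightarrow> 's patom \<Rightarrow> bool" where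
  "supports lt X R a \<longleftrightarrow> psat X (tau_body lt (body_of R)) \<and>
     (\<exists>ts. (hd_of R = Basic (fst a) ts \<or> hd_of R = Choice (fst a) ts \<and> a \<in> X) \<and>
        snd a \<in> tuple_vals ts)"

text \<open>The propositional counterpart of the completion: the first conjunct corresponds to the
  completed definitions, the second to the constraints.\<close>

definition completed ::
    "('s pterm \<Rightarrow> 's pterm \<Rightarrow> bool) \<Rightarrow> 's rule set \<Rightarrow> 's psym set \<Rightarrow> 's patom set \<Rightarrow> bool" where
  "completed lt G intens X \<longleftrightarrow>
     (\<forall>a. pred_of a \<in> intens \<longrightarrow> (a \<in> X \<longleftrightarrow> (\<exists>R\<in>G. supports lt X R a))) \<and>
     (\<forall>R\<in>G. hd_of R = Constraint \<longrightarrow> \<not> psat X (tau_body lt (body_of R)))"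

section \<open>Antecedents and consequents of translated rules\<close>

lemma uclosure_FImp_inject: "uclosure (FImp F G) = uclosure (FImp F' G') \<longleftrightarrow> F = F' \<and> G = G'"
proof -
  \<comment> \<open>An implication is not a universal formula, so stripping the leading quantifiers
    stops at the same place on both sides. The lists are arbitrary because the enumeration in a
    closure depends on the formula.\<close>
  have "F = F' \<and> G = G'" if "FAlls xs (FImp F G) = FAlls ys (FImp F' G')" for xs ys
    using that
  proof (induction xs arbitrary: ys)
    case Nil
    then show ?case by (cases ys) (auto simp: FAlls_def)
  next
    case (Cons x xs)
    then show ?case by (cases ys) (auto simp: FAlls_def)
  qed
  then show ?thesis by (auto simp: uclosure_def)
qed

definition rule_ante :: "nat set \<Rightarrow> 's rule \<Rightarrow> 's fm" where
  "rule_ante X R = (case hd_of R of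
      Basic p ts \<Rightarrow> FAnd (valf_tuple ts (new_vars X (length ts))) (tauB X (body_of R))
    | Choice p ts \<Rightarrow>
        FAnd (FAnd (valf_tuple ts (new_vars X (length ts))) (tauB X (body_of R)))
          (FNot (FNot (pred_fm p (new_vars X (length ts)))))
    | Constraint \<Rightarrow> tauB X (body_of R))"

definition rule_cons :: "nat set \<Rightarrow> 's rule \<Rightarrow> 's fm" where
  "rule_cons X R = (case hd_of R of
      Basic p ts \<Rightarrow> pred_fm p (new_vars X (length ts))
    | Choice p ts \<Rightarrow> pred_fm p (new_vars X (length ts))
    | Constraint \<Rightarrow> FBot)"

lemma tau_star_rule_eq: "tau_star_rule X R = uclosure (FImp (rule_ante X R) (rule_cons X R))"
  by (simp add: tau_star_rule_def rule_ante_def rule_cons_def Let_def split: head.split)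

text \<open>The length of the variable tuple reveals the arity, so the defining members of
  \<open>p/n\<close> are exactly the translations of rules whose head symbol is
  \<open>p/n\<close>.\<close>

lemma rule_cons_eq_pred_fm:
  "rule_cons X R = pred_fm p (new_vars X n) \<longleftrightarrow>
     (\<exists>ts. (hd_of R = Basic p ts \<or> hd_of R = Choice p ts) \<and> length ts = n)"
proof -
  have "pred_fm q (new_vars X m) = pred_fm p (new_vars X n) \<longleftrightarrow> q = p \<and> m = n" for q m
    by (auto simp: pred_fm_def new_vars_def dest: map_eq_imp_length_eq)
  moreover have "FBot \<noteq> pred_fm p (new_vars X n)" by (simp add: pred_fm_def)
  ultimately show ?thesis by (auto simp: rule_cons_def split: head.split)
qed

lemma first_order_rule:
  "first_order (rule_ante X R)" "first_order (rule_cons X R)"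
proof -
  have b: "first_order (binop_fm f i j k V)" for f i j k and V :: "'a gtm"
    by (cases f) (auto simp: quot_def by_sign_def)
  have v: "first_order (valf t V)" for t :: "'a tm" and V
    by (induction t arbitrary: V) (auto simp: Let_def b)
  have t: "first_order (valf_tuple ts Vs)" for ts :: "'a tm list" and Vs
    by (auto simp: valf_tuple_def first_order_folds v dest: set_zip_leftD)
  have l: "first_order (tauB_blit X l)" for l :: "'a blit"
    by (cases l) (auto simp: Let_def first_order_folds t pred_fm_def)
  show "first_order (rule_ante X R)" "first_order (rule_cons X R)"
    by (auto simp: rule_ante_def rule_cons_def tauB_def first_order_folds l t pred_fm_def
        split: head.split)
qed

lemma first_order_completion_fm:
  assumes "finite intens" "finite \<Pi>"
  shows "first_order (completion_fm Vs intens (tau_star \<Pi>))"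
proof -
  define \<Gamma> where "\<Gamma> = tau_star \<Pi>"
  have fin: "finite \<Gamma>" using assms by (simp add: \<Gamma>_def tau_star_def)
  have fm: "first_order F \<and> first_order G" if "uclosure (FImp F G) \<in> \<Gamma>" for F G
    using that first_order_rule
    by (auto simp: \<Gamma>_def tau_star_def tau_star_rule_eq uclosure_FImp_inject)
  \<comment> \<open>\<open>listing\<close> enumerates finite sets only. This set is the preimage of
    the finite set \<open>\<Gamma>\<close> under an injective map.\<close>
  have "finite {F. uclosure (FImp F G) \<in> \<Gamma>}" for G
    using finite_vimageI[OF fin, of "\<lambda>F. uclosure (FImp F G)"]
    by (simp add: inj_def uclosure_FImp_inject vimage_def)
  with fm have "first_order (completed_def Vs \<Gamma> P)" for P
    by (auto simp: completed_def_def Let_def first_order_folds pred_fm_def listing)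
  moreover have "finite {S \<in> \<Gamma>. Q S}" for Q using fin by simp
  ultimately show ?thesis
    using fm assms by (auto simp: completion_fm_def first_order_folds listing \<Gamma>_def[symmetric])
qed

text \<open>A standard interpretation is determined, as far as formulas can tell, by a valuation of
  the placeholders and the extents of the predicates. The former is recorded by \<open>v\<close>,
  the latter are collected in \<open>truths\<close> below.\<close>

locale standard_interp =
  fixes lt :: "'s pterm \<Rightarrow> 's pterm \<Rightarrow> bool" and PH :: "'s set"
    and v :: "'s \<Rightarrow> 's pterm" and M :: "('s, 's pterm) interp"
  assumes lt: "precomputed_order lt" and std: "standard_for lt PH M" and cst: "cst M = apply_val PH v"
begin

definition truths :: "'s patom set" where
  "truths = {(p, rs). prd M p rs}"

text \<open>Program variables are general variables, so the general part of an assignment is a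
  ground substitution for rules.\<close>

definition asg :: "(fvar \<Rightarrow> 's pterm) \<Rightarrow> nat \<Rightarrow> 's pterm" where
  "asg e x = e (GV x)"

abbreviation inst_tm :: "(nat \<Rightarrow> 's pterm) \<Rightarrow> 's tm \<Rightarrow> 's tm" where
  "inst_tm \<sigma> t \<equiv> subst_tm \<sigma> (val_tm PH v t)"

abbreviation inst_blit :: "(nat \<Rightarrow> 's pterm) \<Rightarrow> 's blit \<Rightarrow> 's blit" where
  "inst_blit \<sigma> l \<equiv> map_blit_tms (subst_tm \<sigma>) (map_blit_tms (val_tm PH v) l)"

abbreviation inst_rule :: "(nat \<Rightarrow> 's pterm) \<Rightarrow> 's rule \<Rightarrow> 's rule" where
  "inst_rule \<sigma> R \<equiv> map_rule_tms (subst_tm \<sigma>) (map_rule_tms (val_tm PH v) R)"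

lemma std_simps [simp]:
  "gdom M = UNIV" "idom M = range Num" "cst M (Num n) = Num n"
  "absf M (Num n) = Num \<bar>n\<bar>" "opf M f (Num i) (Num j) = Num (arith f i j)"
  "c \<noteq> EQ \<Longrightarrow> relf M c r s \<longleftrightarrow> rel_holds lt c r s"
  using std by (auto simp: standard_for_def)

lemma gtm_val_var_gtm [simp]: "gtm_val M e (var_gtm V) = e V"
  by (cases V) auto

lemma gtm_val_const_gtm [simp]: "gtm_val M e (const_gtm r) = apply_val PH v r"
  by (cases r) (auto simp: cst[symmetric])

lemma sat_FRel [simp]: "sat M e E (FRel c t u) \<longleftrightarrow> rel_holds lt c (gtm_val M e t) (gtm_val M e u)"
  by (cases "c = EQ") auto

lemma rel_Num [simp]:
  "rel_holds lt LT (Num m) (Num n) \<longleftrightarrow> m < n" "rel_holds lt LE (Num m) (Num n) \<longleftrightarrow> m \<le> n"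
  "rel_holds lt GE (Num m) (Num n) \<longleftrightarrow> m \<ge> n"
  using lt by (auto simp: precomputed_order_def)

lemma sat_quot:
  assumes "e (IV i) = Num m" "e (IV j) = Num n" "e (IV k) = Num q"
  shows "sat M e E (quot (IVar i) (IVar j) (IVar k)) \<longleftrightarrow> n \<noteq> 0 \<and> q = \<bar>m\<bar> div \<bar>n\<bar>"
  unfolding quotient_bounds_iff[symmetric]
  using assms by (simp only: quot_def sat.simps(5) sat_FRel gtm_val.simps itm_val.simps std_simps
      arith.simps rel_Num)

lemma sat_binop_fm:
  assumes e: "e (IV i) = Num m" "e (IV j) = Num n"
    and k: "k \<noteq> i" "k \<noteq> j" "V \<noteq> IV k"
  shows "sat M e E (binop_fm f i j k (var_gtm V)) \<longleftrightarrow> (\<exists>q\<in>binop_vals f m n. e V = Num q)"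
proof -
  \<comment> \<open>The freshness of \<open>k\<close> ensures that binding the quotient or interval
    variable does not disturb the result variable.\<close>
  have V: "gtm_val M (e(IV k := d)) (var_gtm V) = e V" for d using k by (cases V) auto
  have q: "sat M (e(IV k := Num q)) E (quot (IVar i) (IVar j) (IVar k)) \<longleftrightarrow>
      n \<noteq> 0 \<and> q = \<bar>m\<bar> div \<bar>n\<bar>" for q
    using e k by (intro sat_quot) auto
  show ?thesis
  proof (cases f)
    case (Arith g)
    then show ?thesis using e by simp
  next
    case Div
    then show ?thesis using e k
      by (auto simp: V q by_sign_def round0_divide simp del: rel_holds.simps(3-6))
  next
    case Mod
    then show ?thesis using e k
      by (auto simp: V q by_sign_def round0_divide mult.commute[of "\<bar>m\<bar> div \<bar>n\<bar>"]
          simp del: rel_holds.simps(3-6))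
  next
    case Interval
    then show ?thesis using e k
      by (auto simp: V simp del: rel_holds.simps(3-6))
  qed
qed

lemma asg_upd_IV [simp]: "asg (e(IV i := d)) = asg e"
  by (auto simp: asg_def)

text \<open>The induction generalizes \<open>V\<close>, since subterms are evaluated into fresh
  integer variables. These range over numerals, which discards non-numeral values of subterms just
  as \<open>vals\<close> does, and rebinding them leaves \<open>asg e\<close> unchanged.\<close>

lemma sat_valf: "sat M e E (valf t V) \<longleftrightarrow> e V \<in> vals (inst_tm (asg e) t)"
proof (induction t arbitrary: e V)
  case (TAbs t)
  have V: "V \<noteq> IV (fresh_int V)" by (cases V) auto
  show ?case using V by (auto simp: Let_def TAbs.IH fun_upd_same fun_upd_other simp del: fun_upd_apply)
next
  case (Bin f t u)
  let ?i = "fresh_int V"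
  have V: "V \<noteq> IV ?i" "V \<noteq> IV (Suc ?i)" "V \<noteq> IV (Suc (Suc ?i))" by (cases V; simp)+
  have *: "sat M (e(IV ?i := Num m, IV (Suc ?i) := Num n)) E (binop_fm f ?i (Suc ?i) (Suc (Suc ?i)) (var_gtm V))
      \<longleftrightarrow> (\<exists>q\<in>binop_vals f m n. e V = Num q)" for m n
    using V by (subst sat_binop_fm) auto
  show ?case by (auto simp: Let_def Bin.IH fun_upd_same fun_upd_other * simp del: fun_upd_apply)
qed (auto simp: asg_def)

lemma sat_valf_tuple:
  assumes "length Vs = length ts"
  shows "sat M e E (valf_tuple ts Vs) \<longleftrightarrow> map (asg e) Vs \<in> tuple_vals (map (inst_tm (asg e)) ts)"
  using assms
  by (induction Vs ts rule: list_induct2) (auto simp: valf_tuple_def sat_valf asg_def[symmetric, of e])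


section \<open>Literals and bodies\<close>

lemma asg_new_vars:
  assumes "length rs = n" "finite X"
  obtains e' where "\<forall>x. x \<notin> GV ` set (new_vars X n) \<longrightarrow> e' x = e x"
    "map (asg e') (new_vars X n) = rs"
proof -
  have "length rs = length (new_vars X n)" using assms new_vars(1) by simp
  from ex_assignment[OF new_vars(2)[OF assms(2)] this, where e = e] obtain e' where
    "\<forall>x. x \<notin> GV ` set (new_vars X n) \<longrightarrow> e' x = e x" "map (\<lambda>x. e' (GV x)) (new_vars X n) = rs" .
  then show ?thesis by (intro that[of e']) (simp_all add: asg_def[abs_def])
qed

lemma inst_tm_cong: "(\<And>x. x \<in> tm_vars t \<Longrightarrow> \<sigma> x = \<sigma>' x) \<Longrightarrow> inst_tm \<sigma> t = inst_tm \<sigma>' t"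
  by (rule subst_tm_cong) simp

lemma inst_blit_cong:
  "(\<And>x. x \<in> blit_vars l \<Longrightarrow> \<sigma> x = \<sigma>' x) \<Longrightarrow> inst_blit \<sigma> l = inst_blit \<sigma>' l"
  by (cases l) (auto intro!: inst_tm_cong)

lemma inst_rule_cong:
  assumes "\<And>x. x \<in> rule_vars R \<Longrightarrow> \<sigma> x = \<sigma>' x"
  shows "inst_rule \<sigma> R = inst_rule \<sigma>' R"
proof -
  have "map_head_tms (subst_tm \<sigma>) (map_head_tms (val_tm PH v) (hd_of R)) =
      map_head_tms (subst_tm \<sigma>') (map_head_tms (val_tm PH v) (hd_of R))"
    using assms by (cases "hd_of R") (auto simp: rule_vars_def intro!: inst_tm_cong)
  moreover have "inst_blit \<sigma> l = inst_blit \<sigma>' l" if "l \<in> set (body_of R)" for l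
    using assms that by (intro inst_blit_cong) (auto simp: rule_vars_def)
  ultimately show ?thesis by (auto simp: map_rule_tms_def)
qed

lemma body_of_inst_rule: "body_of (inst_rule \<sigma> R) = map (inst_blit \<sigma>) (body_of R)"
  by (simp add: map_rule_tms_def)

lemma sat_pred_fm [simp]: "sat M e E (pred_fm p Vs) \<longleftrightarrow> (p, map (asg e) Vs) \<in> truths"
  by (simp add: pred_fm_def truths_def asg_def[abs_def] comp_def)

text \<open>The common pattern of all literal translations. The new variables are distinct and do
  not occur in \<open>ts\<close>, so they can be set to any tuple of values without changing the
  terms; \<open>Q\<close> stands for what the literal says about that tuple.\<close>

lemma sat_FExs_valf_tuple:
  assumes X: "finite X" and vars: "(\<Union>t\<in>set ts. tm_vars t) \<subseteq> X"
    and G: "\<And>e. sat M e E G \<longleftrightarrow> Q (map (asg e) (new_vars X (length ts)))"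
  shows "sat M e E (FExs (map GV (new_vars X (length ts)))
      (FAnd (valf_tuple ts (new_vars X (length ts))) G)) \<longleftrightarrow>
    (\<exists>rs\<in>tuple_vals (map (inst_tm (asg e)) ts). Q rs)" (is "?L \<longleftrightarrow> ?R")
proof -
  let ?Vs = "new_vars X (length ts)"
  note new = new_vars[OF X, of "length ts"]
  have eq: "map (inst_tm (asg e')) ts = map (inst_tm (asg e)) ts"
    if "\<forall>x. x \<notin> GV ` set ?Vs \<longrightarrow> e' x = e x" for e'
  proof (intro map_cong refl inst_tm_cong)
    fix t x assume "t \<in> set ts" "x \<in> tm_vars t"
    with vars new(3) have "x \<notin> set ?Vs" by blast
    then show "asg e' x = asg e x" using that by (auto simp: asg_def)
  qed
  show ?thesis
  proof
    assume ?L
    then obtain e' where e': "\<forall>x. x \<notin> GV ` set ?Vs \<longrightarrow> e' x = e x"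
      "sat M e' E (valf_tuple ts ?Vs)" "sat M e' E G"
      unfolding sat_FExs by auto
    then show ?R using eq[of e'] by (auto simp: sat_valf_tuple[OF new(1)] G)
  next
    assume ?R
    then obtain rs where rs: "rs \<in> tuple_vals (map (inst_tm (asg e)) ts)" "Q rs" by blast
    then have "length rs = length ts" by (auto dest: tuple_vals_length)
    from asg_new_vars[OF this X, where e = e] obtain e'
      where e': "\<forall>x. x \<notin> GV ` set ?Vs \<longrightarrow> e' x = e x" "map (asg e') ?Vs = rs" .
    with rs have "sat M e' E (valf_tuple ts ?Vs)" "sat M e' E G"
      unfolding sat_valf_tuple[OF new(1)] G eq[OF e'(1)] by simp_all
    with e' show ?L unfolding sat_FExs by (intro exI[of _ e']) auto
  qed
qed

lemma sat_tauB_blit: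
  assumes X: "finite X" and vars: "blit_vars l \<subseteq> X"
  shows "sat M e E (tauB_blit X l) \<longleftrightarrow> psat truths (tau_blit lt (inst_blit (asg e) l))"
proof (cases l)
  case (Pos p ts)
  with vars show ?thesis
    by (simp add: Let_def sat_FExs_valf_tuple[OF X, where Q = "\<lambda>rs. (p, rs) \<in> truths"]
        psat_tau_blit comp_def del: tau_blit.simps)
next
  case (Naf p ts)
  with vars show ?thesis
    by (simp add: Let_def sat_FExs_valf_tuple[OF X, where Q = "\<lambda>rs. (p, rs) \<notin> truths"]
        psat_tau_blit comp_def del: tau_blit.simps)
next
  case (NafNaf p ts)
  with vars show ?thesis
    by (simp add: Let_def sat_FExs_valf_tuple[OF X, where Q = "\<lambda>rs. (p, rs) \<in> truths"]
        psat_tau_blit comp_def del: tau_blit.simps)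
next
  case (Comp c t u)
  \<comment> \<open>A comparison is treated as a condition on a tuple of length two, so that the
    common pattern applies to it as well.\<close>
  have pair: "(\<exists>rs\<in>tuple_vals [a, b]. rel_holds lt c (rs ! 0) (rs ! 1)) \<longleftrightarrow>
      (\<exists>r\<in>vals a. \<exists>s\<in>vals b. rel_holds lt c r s)" for a b
  proof -
    have "rs \<in> tuple_vals [a, b] \<longleftrightarrow> (\<exists>r\<in>vals a. \<exists>s\<in>vals b. rs = [r, s])" for rs
      by (auto simp: tuple_vals_def set_Cons_def)
    then have "(\<exists>rs\<in>tuple_vals [a, b]. rel_holds lt c (rs ! 0) (rs ! 1)) \<longleftrightarrow>
        (\<exists>r\<in>vals a. \<exists>s\<in>vals b. \<exists>rs. rs = [r, s] \<and> rel_holds lt c (rs ! 0) (rs ! 1))" by blast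
    then show ?thesis by simp
  qed
  have "sat M e' E (FRel c (GVar (new_vars X 2 ! 0)) (GVar (new_vars X 2 ! 1))) \<longleftrightarrow>
      rel_holds lt c (map (asg e') (new_vars X 2) ! 0) (map (asg e') (new_vars X 2) ! 1)" for e'
    by (simp add: new_vars(1)[OF X] asg_def)
  then show ?thesis
    using Comp vars sat_FExs_valf_tuple[OF X, of "[t, u]" E
      "FRel c (GVar (new_vars X 2 ! 0)) (GVar (new_vars X 2 ! 1))"
      "\<lambda>rs. rel_holds lt c (rs ! 0) (rs ! 1)" e]
    by (simp add: Let_def pair[unfolded One_nat_def] psat_tau_blit numeral_2_eq_2
        del: tau_blit.simps sat_FRel)
qed

section \<open>Rules, completed definitions and the completion\<close>

lemma sat_tauB:
  assumes "finite X" "rule_vars R \<subseteq> X"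
  shows "sat M e E (tauB X (body_of R)) \<longleftrightarrow>
    psat truths (tau_body lt (body_of (inst_rule (asg e) R)))"
proof -
  have "blit_vars l \<subseteq> X" if "l \<in> set (body_of R)" for l
    using that assms(2) by (auto simp: rule_vars_def)
  then show ?thesis
    using assms(1) by (auto simp: tauB_def sat_tauB_blit psat_tau_body body_of_inst_rule)
qed

text \<open>The assignment plays two roles: its values on the variables of the rule select a ground
  instance, and its values on the new variables name the head atom that this instance is to
  support.\<close>

lemma sat_rule_ante:
  assumes X: "finite X" "rule_vars R \<subseteq> X"
    and hd: "hd_of R = Basic p ts \<or> hd_of R = Choice p ts" and n: "n = length ts"
  shows "sat M e E (rule_ante X R) \<longleftrightarrow>
    supports lt truths (inst_rule (asg e) R) (p, map (asg e) (new_vars X n))"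
proof -
  have l: "length (new_vars X (length ts)) = length ts" using new_vars(1)[OF X(1)] .
  show ?thesis using hd
  proof
    assume hd: "hd_of R = Basic p ts"
    then have "hd_of (inst_rule (asg e) R) = Basic p (map (inst_tm (asg e)) ts)"
      by (simp add: map_rule_tms_def)
    with hd show ?thesis
      by (auto simp: n rule_ante_def supports_def sat_valf_tuple[OF l] sat_tauB[OF X])
  next
    assume hd: "hd_of R = Choice p ts"
    then have "hd_of (inst_rule (asg e) R) = Choice p (map (inst_tm (asg e)) ts)"
      by (simp add: map_rule_tms_def)
    with hd show ?thesis
      by (auto simp: n rule_ante_def supports_def sat_valf_tuple[OF l] sat_tauB[OF X])
  qed
qed

lemma ex_sat_rule_ante:
  assumes X: "finite X" "rule_vars R \<subseteq> X"
    and hd: "hd_of R = Basic p ts \<or> hd_of R = Choice p ts" and n: "n = length ts"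
    and rs: "map (asg e) (new_vars X n) = rs"
  shows "sat M e E (FExs (listing (fv (rule_ante X R) - GV ` set (new_vars X n))) (rule_ante X R)) \<longleftrightarrow>
    (\<exists>\<sigma>. supports lt truths (inst_rule \<sigma> R) (p, rs))" (is "?L \<longleftrightarrow> ?R")
proof
  assume ?L
  then obtain e' where e': "\<forall>x\<in>GV ` set (new_vars X n). e' x = e x" "sat M e' E (rule_ante X R)"
    unfolding sat_FExs_fv[OF first_order_rule(1)] by blast
  have "map (asg e') (new_vars X n) = rs" using e'(1) rs by (auto simp: asg_def)
  with e'(2) show ?R unfolding sat_rule_ante[OF X hd n] by blast
next
  assume ?R
  then obtain \<sigma> where \<sigma>: "supports lt truths (inst_rule \<sigma> R) (p, rs)" by blast
  \<comment> \<open>The head tuple is kept from \<open>e\<close>, and everything else follows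
    \<open>\<sigma>\<close>; no variable of the rule is affected by the exception. The numeral 0
    only serves to respect the integer sort.\<close>
  define e' :: "fvar \<Rightarrow> 's pterm" where "e' x = (case x of GV y \<Rightarrow> if y \<in> set (new_vars X n) then e x else \<sigma> y
    | IV i \<Rightarrow> Num 0)" for x
  have "map (asg e') (new_vars X n) = rs" using rs by (auto simp: asg_def e'_def)
  moreover have "inst_rule (asg e') R = inst_rule \<sigma> R"
    using X new_vars(3)[OF X(1), of n] by (intro inst_rule_cong) (auto simp: asg_def e'_def)
  ultimately have "sat M e' E (rule_ante X R)" using \<sigma> unfolding sat_rule_ante[OF X hd n] by simp
  moreover have "\<forall>x\<in>GV ` set (new_vars X n). e' x = e x" by (simp add: e'_def)
  moreover have "e' x \<in> sort_dom M x" for x by (cases x) (auto simp: e'_def)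
  ultimately show ?L unfolding sat_FExs_fv[OF first_order_rule(1)] by blast
qed

lemma sat_constraint:
  assumes X: "finite X" "rule_vars R \<subseteq> X" and hd: "hd_of R = Constraint"
  shows "sat M e E (tau_star_rule X R) \<longleftrightarrow>
    (\<forall>\<sigma>. \<not> psat truths (tau_body lt (body_of (inst_rule \<sigma> R))))" (is "?L \<longleftrightarrow> ?R")
proof -
  have fo: "first_order (FImp (rule_ante X R) (rule_cons X R))" by (simp add: first_order_rule)
  have sat: "sat M e' E (FImp (rule_ante X R) (rule_cons X R)) \<longleftrightarrow>
      \<not> psat truths (tau_body lt (body_of (inst_rule (asg e') R)))" for e'
    using hd by (simp add: rule_ante_def rule_cons_def sat_tauB[OF X])
  show ?thesis
  proof
    assume L: ?L
    show ?R
    proof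
      fix \<sigma> :: "nat \<Rightarrow> 's pterm"
      define e' :: "fvar \<Rightarrow> 's pterm" where "e' x = (case x of GV y \<Rightarrow> \<sigma> y | IV i \<Rightarrow> Num 0)" for x
      have "e' x \<in> sort_dom M x" for x by (cases x) (auto simp: e'_def)
      moreover have "asg e' = \<sigma>" by (auto simp: asg_def e'_def)
      ultimately show "\<not> psat truths (tau_body lt (body_of (inst_rule \<sigma> R)))"
        using L unfolding tau_star_rule_eq sat_uclosure[OF fo] sat by auto
    qed
  next
    assume ?R
    then show ?L unfolding tau_star_rule_eq sat_uclosure[OF fo] sat by blast
  qed
qed

lemma sat_completed_def:
  assumes fin: "finite \<Pi>" "finite (program_vars \<Pi>)"
  shows "sat M e E (completed_def (new_vars (program_vars \<Pi>)) (tau_star \<Pi>) (p, n)) \<longleftrightarrow>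
    (\<forall>rs. length rs = n \<longrightarrow>
      ((p, rs) \<in> truths \<longleftrightarrow> (\<exists>R\<in>\<Pi>. \<exists>\<sigma>. supports lt truths (inst_rule \<sigma> R) (p, rs))))"
    (is "?L \<longleftrightarrow> ?R")
proof -
  let ?X = "program_vars \<Pi>"
  let ?V = "new_vars ?X n"
  define S where "S = {F. uclosure (FImp F (pred_fm p ?V)) \<in> tau_star \<Pi>}"
  \<comment> \<open>By injectivity of the closure, the disjuncts of the completed definition come
    from the rules with this head, and from nothing else.\<close>
  have S: "S = rule_ante ?X ` {R\<in>\<Pi>. rule_cons ?X R = pred_fm p ?V}"
    by (auto simp: S_def tau_star_def tau_star_rule_eq uclosure_FImp_inject image_iff)
  then have finS: "finite S" using fin by simp
  have vars: "rule_vars R \<subseteq> ?X" if "R \<in> \<Pi>" for R using that by (auto simp: program_vars_def)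
  have disj: "(\<exists>F\<in>S. sat M e' E (FExs (listing (fv F - GV ` set ?V)) F)) \<longleftrightarrow>
      (\<exists>R\<in>\<Pi>. \<exists>\<sigma>. supports lt truths (inst_rule \<sigma> R) (p, rs))"
    if rs: "map (asg e') ?V = rs" for e' rs
  proof -
    have "sat M e' E (FExs (listing (fv (rule_ante ?X R) - GV ` set ?V)) (rule_ante ?X R)) \<longleftrightarrow>
        (\<exists>\<sigma>. supports lt truths (inst_rule \<sigma> R) (p, rs))"
      if "R \<in> \<Pi>" "rule_cons ?X R = pred_fm p ?V" for R
      using that rs ex_sat_rule_ante[OF fin(2) vars] unfolding rule_cons_eq_pred_fm by blast
    \<comment> \<open>A supporting rule has a head with the right name, and the length of the
      supported tuple forces the right arity. Hence the existential quantifier may range over all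
      rules.\<close>
    moreover have "rule_cons ?X R = pred_fm p ?V"
      if "supports lt truths (inst_rule \<sigma> R) (p, rs)" for R \<sigma>
    proof -
      have "length rs = n" using rs new_vars(1)[OF fin(2), of n] by auto
      with that show ?thesis unfolding rule_cons_eq_pred_fm
        by (cases "hd_of R") (auto simp: supports_def map_rule_tms_def dest: tuple_vals_length)
    qed
    ultimately show ?thesis unfolding S by blast
  qed
  have "?L \<longleftrightarrow> (\<forall>e'. (\<forall>x. x \<notin> GV ` set ?V \<longrightarrow> e' x = e x) \<longrightarrow>
      ((p, map (asg e') ?V) \<in> truths \<longleftrightarrow>
        (\<exists>F\<in>S. sat M e' E (FExs (listing (fv F - GV ` set ?V)) F))))"
    by (auto simp: completed_def_def Let_def sat_FAlls S_def[symmetric] listing finS)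
  also have "\<dots> \<longleftrightarrow> (\<forall>e'. (\<forall>x. x \<notin> GV ` set ?V \<longrightarrow> e' x = e x) \<longrightarrow>
      ((p, map (asg e') ?V) \<in> truths \<longleftrightarrow>
        (\<exists>R\<in>\<Pi>. \<exists>\<sigma>. supports lt truths (inst_rule \<sigma> R) (p, map (asg e') ?V))))"
    unfolding disj[OF refl] ..
  also have "\<dots> \<longleftrightarrow> ?R" (is "?M \<longleftrightarrow> _")
  proof
    assume L: ?M
    show ?R
    proof (intro allI impI)
      fix rs :: "'s pterm list" assume "length rs = n"
      from asg_new_vars[OF this fin(2), where e = e] obtain e' where
        "\<forall>x. x \<notin> GV ` set ?V \<longrightarrow> e' x = e x" "map (asg e') ?V = rs" .
      with L show "(p, rs) \<in> truths \<longleftrightarrow>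
          (\<exists>R\<in>\<Pi>. \<exists>\<sigma>. supports lt truths (inst_rule \<sigma> R) (p, rs))" by blast
    qed
  next
    assume ?R
    moreover have "length (map (asg e') ?V) = n" for e' using new_vars(1)[OF fin(2)] by simp
    ultimately show ?M by blast
  qed
  finally show ?thesis .
qed

lemma sat_completion_fm:
  assumes fin: "finite \<Pi>" "finite (program_vars \<Pi>)" "finite intens"
    and heads: "\<And>R. R \<in> \<Pi> \<Longrightarrow> head_preds (hd_of R) \<subseteq> intens"
  shows "sat M e E (completion_fm (new_vars (program_vars \<Pi>)) intens (tau_star \<Pi>)) \<longleftrightarrow>
    completed lt (instances (val_program PH v \<Pi>)) intens truths"
proof -
  let ?X = "program_vars \<Pi>"
  let ?G = "instances (val_program PH v \<Pi>)"
  define C where "C = {S \<in> tau_star \<Pi>. \<exists>F G. S = uclosure (FImp F G) \<and> preds G \<inter> intens = {}}"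
  have vars: "rule_vars R \<subseteq> ?X" if "R \<in> \<Pi>" for R using that by (auto simp: program_vars_def)
  have G: "(\<exists>R\<in>?G. Q R) \<longleftrightarrow> (\<exists>R\<in>\<Pi>. \<exists>\<sigma>. Q (inst_rule \<sigma> R))"
    "(\<forall>R\<in>?G. Q R) \<longleftrightarrow> (\<forall>R\<in>\<Pi>. \<forall>\<sigma>. Q (inst_rule \<sigma> R))" for Q
    by (auto simp: instances_def val_program_def)
  \<comment> \<open>Since every head symbol is intensional, the members that the completion keeps
    unchanged are exactly the translated constraints.\<close>
  have "preds (rule_cons ?X R) \<inter> intens = {} \<longleftrightarrow> hd_of R = Constraint" if "R \<in> \<Pi>" for R
    using heads[OF that] new_vars(1)[OF fin(2)]
    by (cases "hd_of R") (auto simp: rule_cons_def pred_fm_def)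
  then have C: "C = tau_star_rule ?X ` {R\<in>\<Pi>. hd_of R = Constraint}"
    by (auto simp: C_def tau_star_def tau_star_rule_eq uclosure_FImp_inject)
  then have finC: "finite C" using fin by simp
  have "(\<forall>S\<in>C. sat M e E S) \<longleftrightarrow>
      (\<forall>R\<in>\<Pi>. hd_of R = Constraint \<longrightarrow> (\<forall>\<sigma>. \<not> psat truths (tau_body lt (body_of (inst_rule \<sigma> R)))))"
    using sat_constraint[OF fin(2) vars] unfolding C by blast
  also have "\<dots> \<longleftrightarrow> (\<forall>R\<in>?G. hd_of R = Constraint \<longrightarrow> \<not> psat truths (tau_body lt (body_of R)))"
  proof -
    have "hd_of (inst_rule \<sigma> R) = Constraint \<longleftrightarrow> hd_of R = Constraint" for \<sigma> R
      by (cases "hd_of R") (auto simp: map_rule_tms_def)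
    then show ?thesis unfolding G by blast
  qed
  finally have constraints: "(\<forall>S\<in>C. sat M e E S) \<longleftrightarrow>
    (\<forall>R\<in>?G. hd_of R = Constraint \<longrightarrow> \<not> psat truths (tau_body lt (body_of R)))" .
  have "(\<forall>P\<in>intens. sat M e E (completed_def (new_vars ?X) (tau_star \<Pi>) P)) \<longleftrightarrow>
      (\<forall>p n. (p, n) \<in> intens \<longrightarrow> (\<forall>rs. length rs = n \<longrightarrow>
        ((p, rs) \<in> truths \<longleftrightarrow> (\<exists>R\<in>?G. supports lt truths R (p, rs)))))"
    by (simp add: Ball_def[of intens] G sat_completed_def[OF fin(1,2)])
  also have "\<dots> \<longleftrightarrow> (\<forall>a. pred_of a \<in> intens \<longrightarrow> (a \<in> truths \<longleftrightarrow> (\<exists>R\<in>?G. supports lt truths R a)))"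
    by (auto simp: pred_of_def)
  finally show ?thesis
    using constraints
    by (auto simp: completion_fm_def completed_def listing fin finC C_def[symmetric]
        simp del: split_paired_All)
qed

end

section \<open>Stable models and completion\<close>

lemma psat_reduct_imp_psat: "psat Y (reduct X F) \<Longrightarrow> psat X F"
  by (cases F) (auto split: if_splits)

lemma psat_reduct_self: "psat X (reduct X F) \<longleftrightarrow> psat X F"
  by (induction F) auto

text \<open>A satisfied reduct forces the original formula to hold in \<open>X\<close>. The side
  condition of the reduct is therefore redundant for conjunctions and disjunctions, and a negation
  is decided by \<open>X\<close> alone.\<close>

lemma psat_reduct_connectives:
  "psat Y (reduct X (PImp F G)) \<longleftrightarrow>
     psat X (PImp F G) \<and> (psat Y (reduct X F) \<longrightarrow> psat Y (reduct X G))"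
  "psat Y (reduct X (POr F G)) \<longleftrightarrow> psat Y (reduct X F) \<or> psat Y (reduct X G)"
  "psat Y (reduct X (PNot F)) \<longleftrightarrow> \<not> psat X F"
  "psat Y (reduct X (PConj Fs)) \<longleftrightarrow> (\<forall>F\<in>set Fs. psat Y (reduct X F))"
  "psat Y (reduct X (PDisj Fs)) \<longleftrightarrow> (\<exists>F\<in>set Fs. psat Y (reduct X F))"
proof -
  have conj: "psat Y (reduct X (PAnd F G)) \<longleftrightarrow> psat Y (reduct X F) \<and> psat Y (reduct X G)"
    for F G :: "'a pf" by (auto dest: psat_reduct_imp_psat)
  have disj: "psat Y (reduct X (POr F G)) \<longleftrightarrow> psat Y (reduct X F) \<or> psat Y (reduct X G)"
    for F G :: "'a pf" by (auto dest: psat_reduct_imp_psat)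
  show "psat Y (reduct X (POr F G)) \<longleftrightarrow> psat Y (reduct X F) \<or> psat Y (reduct X G)"
    by (fact disj)
  show "psat Y (reduct X (PConj Fs)) \<longleftrightarrow> (\<forall>F\<in>set Fs. psat Y (reduct X F))"
    unfolding PConj_def by (induction Fs) (simp_all add: conj PTop_def del: reduct.simps(3))
  show "psat Y (reduct X (PDisj Fs)) \<longleftrightarrow> (\<exists>F\<in>set Fs. psat Y (reduct X F))"
    unfolding PDisj_def by (induction Fs) (simp_all add: disj del: reduct.simps(4))
qed (auto simp: PNot_def dest: psat_reduct_imp_psat)

text \<open>Only positive literals keep a dependence on \<open>Y\<close>; this is why only they
  contribute edges to the dependency graph.\<close>

lemma psat_reduct_tau_blit:
  "psat Y (reduct X (tau_blit lt (Pos p ts))) \<longleftrightarrow> (\<exists>r\<in>tuple_vals ts. (p, r) \<in> X \<and> (p, r) \<in> Y)"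
  "(\<And>p ts. l \<noteq> Pos p ts) \<Longrightarrow> psat Y (reduct X (tau_blit lt l)) \<longleftrightarrow> psat X (tau_blit lt l)"
proof -
  show "psat Y (reduct X (tau_blit lt (Pos p ts))) \<longleftrightarrow>
      (\<exists>r\<in>tuple_vals ts. (p, r) \<in> X \<and> (p, r) \<in> Y)"
    by (auto simp: psat_reduct_connectives listing finite_tuple_vals split: if_splits)
  show "psat Y (reduct X (tau_blit lt l)) \<longleftrightarrow> psat X (tau_blit lt l)" if "\<And>p ts. l \<noteq> Pos p ts"
    using that by (cases l) (auto simp: psat_reduct_connectives listing finite_tuple_vals PTop_def)
qed

lemma psat_tau_rule:
  "psat X (tau_rule lt R) \<longleftrightarrow> (psat X (tau_body lt (body_of R)) \<longrightarrow>
     (case hd_of R of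
        Basic p ts \<Rightarrow> \<forall>r\<in>tuple_vals ts. (p, r) \<in> X
      | Choice p ts \<Rightarrow> True
      | Constraint \<Rightarrow> False))"
  by (auto simp: tau_rule_def listing finite_tuple_vals split: head.split)

text \<open>In a choice head the disjunct \<open>\<not> p(r)\<close> survives in the reduct exactly
  when the atom is absent from \<open>X\<close>; otherwise the reduct demands the atom in
  \<open>Y\<close>.\<close>

lemma psat_reduct_tau_rule:
  "psat Y (reduct X (tau_rule lt R)) \<longleftrightarrow> psat X (tau_rule lt R) \<and>
     (psat Y (reduct X (tau_body lt (body_of R))) \<longrightarrow>
     (case hd_of R of
        Basic p ts \<Rightarrow> \<forall>r\<in>tuple_vals ts. (p, r) \<in> X \<and> (p, r) \<in> Y
      | Choice p ts \<Rightarrow> \<forall>r\<in>tuple_vals ts. (p, r) \<in> X \<longrightarrow> (p, r) \<in> Y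
      | Constraint \<Rightarrow> True))"
proof (cases "hd_of R")
  case (Basic p ts)
  then show ?thesis
    by (auto simp: tau_rule_def psat_reduct_connectives listing finite_tuple_vals
        simp del: reduct.simps(2-5) split: if_splits)
next
  case (Choice p ts)
  then show ?thesis
    by (auto simp: tau_rule_def psat_reduct_connectives listing finite_tuple_vals
        simp del: reduct.simps(2-5) split: if_splits)
next
  case Constraint
  then show ?thesis by (auto simp: tau_rule_def psat_reduct_connectives)
qed

lemma stable_model_iff:
  "stable_model lt \<Pi> X \<longleftrightarrow> (\<forall>R\<in>instances \<Pi>. psat X (tau_rule lt R)) \<and>
     (\<forall>Y. Y \<subset> X \<longrightarrow> (\<exists>R\<in>instances \<Pi>. \<not> psat Y (reduct X (tau_rule lt R))))"
  by (auto simp: stable_model_def stable_model_pf_def psat_reduct_self)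

text \<open>By minimality, \<open>X - {a}\<close> violates the reduct of some rule. Its body holds
  in \<open>X\<close>, and \<open>a\<close> is the only atom whose removal can break the head, so
  this rule supports \<open>a\<close>.\<close>

lemma stable_model_supported:
  assumes X: "stable_model lt \<Pi> X" and a: "a \<in> X"
  obtains R where "R \<in> instances \<Pi>" "supports lt X R a"
proof -
  have "X - {a} \<subset> X" using a by blast
  then obtain R where R: "R \<in> instances \<Pi>" "\<not> psat (X - {a}) (reduct X (tau_rule lt R))"
    using X unfolding stable_model_iff by blast
  moreover have sat: "psat X (tau_rule lt R)" using X R(1) by (simp add: stable_model_iff)
  ultimately have body: "psat (X - {a}) (reduct X (tau_body lt (body_of R)))"
    unfolding psat_reduct_tau_rule by blast
  then have "psat X (tau_body lt (body_of R))" by (rule psat_reduct_imp_psat)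
  with R(2) sat body have "supports lt X R a"
    unfolding psat_reduct_tau_rule by (cases "hd_of R") (auto simp: supports_def psat_tau_rule a)
  with R(1) that show ?thesis by blast
qed

section \<open>Input facts and irrelevant atoms\<close>

lemma tuple_vals_Pre [simp]: "tuple_vals (map Pre rs) = {rs}"
  by (induction rs) (auto simp: tuple_vals_def set_Cons_def)

lemma instances_Un: "instances (\<Pi> \<union> \<Pi>') = instances \<Pi> \<union> instances \<Pi>'"
  by (auto simp: instances_def)

lemma instances_facts: "instances (fact_rule ` I) = fact_rule ` I"
proof -
  have inst: "map_rule_tms (subst_tm \<sigma>) (fact_rule a) = fact_rule a" for \<sigma> and a :: "'a patom"
    by (simp add: fact_rule_def map_rule_tms_def comp_def)
  then have "fact_rule a \<in> instances (fact_rule ` I)" if "a \<in> I" for a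
    unfolding instances_def using that by (intro CollectI exI[of _ "\<lambda>_. Num 0"] exI[of _ "fact_rule a"]) simp
  then show ?thesis by (auto simp: instances_def inst)
qed

lemma psat_fact_rule: "psat X (tau_rule lt (fact_rule a)) \<longleftrightarrow> a \<in> X"
  by (simp add: psat_tau_rule psat_tau_body fact_rule_def)

lemma supports_fact_rule: "supports lt X (fact_rule b) a \<longleftrightarrow> a = b"
  by (auto simp: supports_def psat_tau_body fact_rule_def prod_eq_iff)

lemma psat_tau_blit_restrict:
  assumes "blit_preds l \<subseteq> K"
  shows "psat {a \<in> X. pred_of a \<in> K} (tau_blit lt l) \<longleftrightarrow> psat X (tau_blit lt l)"
  using assms
  by (cases l; simp add: psat_tau_blit pred_of_def del: tau_blit.simps; metis tuple_vals_length)

text \<open>Interpretations may make atoms true whose symbols are foreign to the program, whereas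
  stable models contain no such atoms. This lemma allows them to be dropped.\<close>

lemma completed_restrict:
  assumes "intens \<subseteq> K" and "\<And>R l. R \<in> G \<Longrightarrow> l \<in> set (body_of R) \<Longrightarrow> blit_preds l \<subseteq> K"
  shows "completed lt G intens {a \<in> X. pred_of a \<in> K} \<longleftrightarrow> completed lt G intens X"
proof -
  have "psat {a \<in> X. pred_of a \<in> K} (tau_body lt (body_of R)) \<longleftrightarrow> psat X (tau_body lt (body_of R))"
    if "R \<in> G" for R
    using assms(2)[OF that] by (auto simp: psat_tau_body psat_tau_blit_restrict)
  moreover have "pred_of a \<in> intens \<Longrightarrow> pred_of a \<in> K" for a :: "'a patom" using assms(1) by blast
  ultimately show ?thesis unfolding completed_def supports_def by (simp cong: conj_cong)
qed

section \<open>Stable models of io-programs versus completed sets of atoms\<close>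

definition intens :: "'s io_prog \<Rightarrow> 's psym set" where
  "intens \<Omega> = outs \<Omega> \<union> priv_preds \<Omega>"

abbreviation ground_rules :: "'s io_prog \<Rightarrow> ('s \<Rightarrow> 's pterm) \<Rightarrow> 's rule set" where
  "ground_rules \<Omega> v \<equiv> instances (val_program (placeholders \<Omega>) v (rules \<Omega>))"

lemma ins_intens_disjoint: "io_program \<Omega> \<Longrightarrow> ins \<Omega> \<inter> intens \<Omega> = {}"
  by (auto simp: io_program_def intens_def priv_preds_def pub_preds_def)

lemma head_preds_intens:
  assumes "io_program \<Omega>" "R \<in> rules \<Omega>"
  shows "head_preds (hd_of R) \<subseteq> intens \<Omega>"
  using assms
  by (auto simp: io_program_def intens_def priv_preds_def pub_preds_def program_preds_def
      rule_preds_def)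

lemma ground_rules_preds:
  assumes "io_program \<Omega>" "R \<in> ground_rules \<Omega> v"
  shows "head_preds (hd_of R) \<subseteq> intens \<Omega>"
    and "l \<in> set (body_of R) \<Longrightarrow> blit_preds l \<subseteq> ins \<Omega> \<union> intens \<Omega>"
proof -
  from assms(2) obtain \<sigma> R0 where R0: "R0 \<in> rules \<Omega>"
    "R = map_rule_tms (subst_tm \<sigma>) (map_rule_tms (val_tm (placeholders \<Omega>) v) R0)"
    by (auto simp: instances_def val_program_def)
  have h: "head_preds (map_head_tms f h) = head_preds h" for f :: "'a tm \<Rightarrow> 'a tm" and h
    by (cases h) auto
  have b: "blit_preds (map_blit_tms f l) = blit_preds l" for f :: "'a tm \<Rightarrow> 'a tm" and l
    by (cases l) auto
  show "head_preds (hd_of R) \<subseteq> intens \<Omega>"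
    using head_preds_intens[OF assms(1) R0(1)] by (simp add: R0(2) map_rule_tms_def h)
  assume "l \<in> set (body_of R)"
  then obtain l0 where "l0 \<in> set (body_of R0)" "blit_preds l = blit_preds l0"
    by (auto simp: R0(2) map_rule_tms_def b)
  then have "blit_preds l \<subseteq> program_preds (rules \<Omega>)"
    using R0(1) by (auto simp: program_preds_def rule_preds_def)
  then show "blit_preds l \<subseteq> ins \<Omega> \<union> intens \<Omega>"
    by (auto simp: intens_def priv_preds_def pub_preds_def)
qed

lemma supports_head_preds: "supports lt X R a \<Longrightarrow> pred_of a \<in> head_preds (hd_of R)"
  by (auto simp: supports_def pred_of_def dest: tuple_vals_length)

lemma stable_model_completed:
  assumes io: "io_program \<Omega>" and I: "\<forall>a\<in>I. pred_of a \<in> ins \<Omega>"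
    and X: "stable_model lt (val_program (placeholders \<Omega>) v (rules \<Omega>) \<union> fact_rule ` I) X"
  shows "\<forall>a\<in>X. pred_of a \<in> ins \<Omega> \<union> intens \<Omega>" "{a \<in> X. pred_of a \<in> ins \<Omega>} = I"
    "completed lt (ground_rules \<Omega> v) (intens \<Omega>) X"
proof -
  let ?G = "ground_rules \<Omega> v"
  note disj = ins_intens_disjoint[OF io]
  have all: "\<forall>R\<in>?G \<union> fact_rule ` I. psat X (tau_rule lt R)"
    using X unfolding stable_model_iff instances_Un instances_facts by (rule conjunct1)
  then have sat: "psat X (tau_rule lt R)" if "R \<in> ?G" for R using that by blast
  have IX: "I \<subseteq> X" using all psat_fact_rule by blast
  \<comment> \<open>Support comes either from an input fact or from a program rule, and heads of
    program rules are intensional. Hence the input part of \<open>X\<close> cannot exceed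
    \<open>I\<close>, and every intensional atom is supported by the program itself.\<close>
  have supp: "a \<in> I \<or> pred_of a \<in> intens \<Omega> \<and> (\<exists>R\<in>?G. supports lt X R a)" if "a \<in> X" for a
  proof -
    from stable_model_supported[OF X that] obtain R where
      "R \<in> instances (val_program (placeholders \<Omega>) v (rules \<Omega>) \<union> fact_rule ` I)"
      "supports lt X R a" .
    then consider "R \<in> ?G" "supports lt X R a" | "a \<in> I"
      by (auto simp: instances_Un instances_facts supports_fact_rule)
    then show ?thesis
      using ground_rules_preds(1)[OF io] supports_head_preds by cases blast+
  qed
  show "\<forall>a\<in>X. pred_of a \<in> ins \<Omega> \<union> intens \<Omega>" using supp I by blast
  show "{a \<in> X. pred_of a \<in> ins \<Omega>} = I" using supp I IX disj by blast
  have "a \<in> X" if "R \<in> ?G" "supports lt X R a" for R a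
    using sat[OF that(1)] that(2) by (cases a) (auto simp: supports_def psat_tau_rule)
  moreover have "\<not> psat X (tau_body lt (body_of R))" if "R \<in> ?G" "hd_of R = Constraint" for R
    using sat[OF that(1)] that(2) by (auto simp: psat_tau_rule)
  ultimately show "completed lt ?G (intens \<Omega>) X"
    using supp I disj unfolding completed_def by blast
qed

text \<open>Local tightness is needed for minimality only: without it the atoms of \<open>X\<close>
  could support each other in a cycle or along an infinite chain.\<close>

lemma completed_stable_model:
  assumes io: "io_program \<Omega>" and tight: "locally_tight lt \<Omega> v I"
    and preds: "\<forall>a\<in>X. pred_of a \<in> ins \<Omega> \<union> intens \<Omega>" and I: "{a \<in> X. pred_of a \<in> ins \<Omega>} = I"
    and comp: "completed lt (ground_rules \<Omega> v) (intens \<Omega>) X"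
  shows "stable_model lt (val_program (placeholders \<Omega>) v (rules \<Omega>) \<union> fact_rule ` I) X"
proof -
  let ?G = "ground_rules \<Omega> v"
  note disj = ins_intens_disjoint[OF io]
  have sat: "psat X (tau_rule lt R)" if R: "R \<in> ?G" for R
  proof (cases "hd_of R")
    case (Basic p ts)
    have "(p, r) \<in> X" if "psat X (tau_body lt (body_of R))" "r \<in> tuple_vals ts" for r
    proof -
      have s: "supports lt X R (p, r)" using that Basic by (simp add: supports_def)
      then have "pred_of (p, r) \<in> intens \<Omega>"
        using supports_head_preds ground_rules_preds(1)[OF io R] by blast
      with s R comp show ?thesis unfolding completed_def by blast
    qed
    with Basic show ?thesis by (auto simp: psat_tau_rule)
  next
    case Constraint
    with R comp show ?thesis by (auto simp: psat_tau_rule completed_def)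
  qed (simp add: psat_tau_rule)
  have no_model: "False" if Y: "Y \<subset> X" and IY: "I \<subseteq> Y"
    and red: "\<And>R. R \<in> ?G \<Longrightarrow> psat Y (reduct X (tau_rule lt R))" for Y
  proof -
    \<comment> \<open>Every atom missing from \<open>Y\<close> has an edge to another occurrence of
      the same defect, so an infinite walk can be built.\<close>
    have "\<exists>b. b \<in> X - Y \<and> dep_edge lt \<Omega> v I a b" if a: "a \<in> X - Y" for a
    proof -
      \<comment> \<open>All input atoms of \<open>X\<close> belong to \<open>I\<close>, which is
        contained in \<open>Y\<close>.\<close>
      have vertex: "pred_of c \<in> intens \<Omega>" if "c \<in> X - Y" for c
        using that preds I IY by blast
      then obtain R where R: "R \<in> ?G" "supports lt X R a"
        using a comp unfolding completed_def by blast
      have body: "psat X (tau_blit lt l)" if "l \<in> set (body_of R)" for l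
        using R(2) that by (auto simp: supports_def psat_tau_body)
      \<comment> \<open>Otherwise the reduct of \<open>R\<close>, which \<open>Y\<close> satisfies,
        would put \<open>a\<close> into \<open>Y\<close>.\<close>
      have "\<not> psat Y (reduct X (tau_body lt (body_of R)))"
        using red[OF R(1)] R(2) a unfolding psat_reduct_tau_rule
        by (cases a) (auto simp: supports_def)
      then obtain l where l: "l \<in> set (body_of R)" "\<not> psat Y (reduct X (tau_blit lt l))"
        by (auto simp: tau_body_def psat_reduct_connectives)
      \<comment> \<open>The body holds in \<open>X\<close>, and the reduct of any other kind of
        literal has the same truth value in \<open>Y\<close> as the literal has in
        \<open>X\<close>.\<close>
      then obtain p ts where pos: "l = Pos p ts"
        using body psat_reduct_tau_blit(2)[of l Y X lt] by blast
      then obtain r where r: "r \<in> tuple_vals ts" "(p, r) \<in> X - Y"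
        using body[OF l(1)] l(2)
        by (auto simp: psat_tau_blit psat_reduct_tau_blit simp del: tau_blit.simps)
      \<comment> \<open>The edge conditions on input literals refer to \<open>I\<close>; truth of
        the body in \<open>X\<close> yields them because both sets agree on input atoms.\<close>
      have inp: "(q, r) \<in> I \<longleftrightarrow> (q, r) \<in> X" if "(q, length ts) \<in> ins \<Omega>" "r \<in> tuple_vals ts" for q r ts
        using that I by (auto simp: pred_of_def dest: tuple_vals_length)
      have "dep_edge lt \<Omega> v I a (p, r)"
        unfolding dep_edge_def
      proof (intro conjI bexI[OF _ R(1)])
        show "dep_vertex \<Omega> a" "dep_vertex \<Omega> (p, r)"
          using vertex a r(2) by (auto simp: dep_vertex_def intens_def)
        show "\<exists>ts. (hd_of R = Basic (fst a) ts \<or> hd_of R = Choice (fst a) ts) \<and> snd a \<in> tuple_vals ts"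
          using R(2) by (auto simp: supports_def)
        show "\<exists>ts. Pos (fst (p, r)) ts \<in> set (body_of R) \<and> snd (p, r) \<in> tuple_vals ts"
          using l(1) pos r(1) by auto
        show "\<forall>q ts. (q, length ts) \<in> ins \<Omega> \<and>
            (Pos q ts \<in> set (body_of R) \<or> NafNaf q ts \<in> set (body_of R)) \<longrightarrow>
            (\<exists>r\<in>tuple_vals ts. (q, r) \<in> I)"
          using body inp by (metis psat_tau_blit(1,3))
        show "\<forall>q ts. (q, length ts) \<in> ins \<Omega> \<and> Naf q ts \<in> set (body_of R) \<longrightarrow>
            (\<exists>r\<in>tuple_vals ts. (q, r) \<notin> I)"
          using body inp by (metis psat_tau_blit(2))
        show "\<forall>c t u. Comp c t u \<in> set (body_of R) \<longrightarrow>
            (\<exists>r\<in>vals t. \<exists>s\<in>vals u. rel_holds lt c r s)"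
          using body by (metis psat_tau_blit(4))
      qed
      with r(2) show ?thesis by blast
    qed
    moreover obtain a where "a \<in> X - Y" using Y by blast
    ultimately obtain w where "\<And>i. w i \<in> X - Y \<and> dep_edge lt \<Omega> v I (w i) (w (Suc i))"
      using dependent_nat_choice[of "\<lambda>_ a. a \<in> X - Y" "\<lambda>_. dep_edge lt \<Omega> v I"] by blast
    with tight show False unfolding locally_tight_def by blast
  qed
  have facts: "I \<subseteq> Y" if "\<forall>R\<in>fact_rule ` I. psat Y (reduct X (tau_rule lt R))" for Y
  proof
    fix a assume "a \<in> I"
    with that have "psat Y (reduct X (tau_rule lt (fact_rule a)))" by blast
    then show "a \<in> Y"
      by (simp add: psat_reduct_tau_rule tau_body_def psat_reduct_connectives fact_rule_def)
  qed
  show ?thesis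
    unfolding stable_model_iff instances_Un instances_facts
  proof (intro conjI allI impI ballI)
    fix R assume "R \<in> ?G \<union> fact_rule ` I"
    then show "psat X (tau_rule lt R)" using sat I by (auto simp: psat_fact_rule)
  next
    fix Y assume Y: "Y \<subset> X"
    show "\<exists>R\<in>?G \<union> fact_rule ` I. \<not> psat Y (reduct X (tau_rule lt R))"
    proof (rule ccontr)
      assume "\<not> ?thesis"
      then have "\<forall>R\<in>?G. psat Y (reduct X (tau_rule lt R))"
        "\<forall>R\<in>fact_rule ` I. psat Y (reduct X (tau_rule lt R))" by blast+
      with no_model[OF Y] facts[of Y] show False by blast
    qed
  qed
qed

section \<open>Completion and io-models\<close>

lemma finite_program_vars: "finite \<Pi> \<Longrightarrow> finite (program_vars \<Pi>)"
proof -
  have t: "finite (tm_vars t)" for t :: "'a tm" by (induction t) auto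
  have l: "finite (blit_vars l)" for l :: "'a blit" by (cases l) (auto simp: t)
  have h: "finite (head_vars h)" for h :: "'a head" by (cases h) (auto simp: t)
  show "finite \<Pi> \<Longrightarrow> finite (program_vars \<Pi>)" by (auto simp: program_vars_def rule_vars_def l h)
qed

lemma finite_program_preds: "finite \<Pi> \<Longrightarrow> finite (program_preds \<Pi>)"
proof -
  have l: "finite (blit_preds l)" for l :: "'a blit" by (cases l) auto
  have h: "finite (head_preds h)" for h :: "'a head" by (cases h) auto
  show "finite \<Pi> \<Longrightarrow> finite (program_preds \<Pi>)" by (auto simp: program_preds_def rule_preds_def l h)
qed

context standard_interp
begin

lemma standard_interp_prd: "standard_interp lt PH v (M\<lparr>prd := Q\<rparr>)"
  using lt std cst by (simp add: standard_interp_def standard_for_def)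

text \<open>The witness \<open>X\<close> joins the public atoms of the interpretation with the
  extents chosen for the private symbols. No tightness enters yet.\<close>

lemma sat_completion:
  assumes io: "io_program \<Omega>" and PH: "placeholders \<Omega> = PH"
  shows "sat M e E (completion \<Omega>) \<longleftrightarrow>
    (\<exists>X. {a \<in> X. pred_of a \<in> pub_preds \<Omega>} = {a \<in> truths. pred_of a \<in> pub_preds \<Omega>} \<and>
       (\<forall>a\<in>X. pred_of a \<in> ins \<Omega> \<union> intens \<Omega>) \<and> completed lt (ground_rules \<Omega> v) (intens \<Omega>) X)"
    (is "_ \<longleftrightarrow> ?R")
proof -
  let ?Q = "priv_preds \<Omega>"
  let ?K = "ins \<Omega> \<union> intens \<Omega>"
  define C where "C = completion_fm (new_vars (program_vars (rules \<Omega>))) (intens \<Omega>) (tau_star (rules \<Omega>))"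
  define N where "N E' = M\<lparr>prd := \<lambda>p ds. if (p, length ds) \<in> ?Q then ds \<in> E' (p, length ds) else prd M p ds\<rparr>"
    for E'
  define T where "T E' = {a. if pred_of a \<in> ?Q then snd a \<in> E' (pred_of a) else a \<in> truths}"
    for E' :: "'s psym \<Rightarrow> 's pterm list set"
  have fin: "finite (rules \<Omega>)" "finite (program_vars (rules \<Omega>))" "finite ?Q" "finite (intens \<Omega>)"
    using io finite_program_vars finite_program_preds
    by (auto simp: io_program_def priv_preds_def intens_def)
  have K: "?K = pub_preds \<Omega> \<union> ?Q" "pub_preds \<Omega> \<inter> ?Q = {}"
    by (auto simp: intens_def pub_preds_def priv_preds_def)
  have sat_C: "sat M e E' (preds_to_vars ?Q C) \<longleftrightarrow> completed lt (ground_rules \<Omega> v) (intens \<Omega>) (T E')"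
    for E'
  proof -
    interpret N: standard_interp lt PH v "N E'" unfolding N_def by (rule standard_interp_prd)
    have "sat M e E' (preds_to_vars ?Q C) \<longleftrightarrow> sat (N E') e E' C"
      unfolding N_def C_def by (intro sat_preds_to_vars first_order_completion_fm fin)
    also have "\<dots> \<longleftrightarrow> completed lt (ground_rules \<Omega> v) (intens \<Omega>) N.truths"
      unfolding C_def PH by (intro N.sat_completion_fm fin head_preds_intens[OF io])
    also have "N.truths = T E'"
      unfolding N.truths_def T_def truths_def by (auto simp: N_def pred_of_def)
    finally show ?thesis .
  qed
  \<comment> \<open>\<open>T E'\<close> may still contain atoms over symbols foreign to the program,
    which \<open>X\<close> must not contain.\<close>
  have restrict: "completed lt (ground_rules \<Omega> v) (intens \<Omega>) {a \<in> X. pred_of a \<in> ?K} \<longleftrightarrow>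
      completed lt (ground_rules \<Omega> v) (intens \<Omega>) X" for X
    using ground_rules_preds(2)[OF io] by (intro completed_restrict) auto
  have "sat M e E (completion \<Omega>) \<longleftrightarrow> (\<exists>E'. (\<forall>P. P \<notin> ?Q \<longrightarrow> E' P = E P) \<and>
      (\<forall>P\<in>?Q. E' P \<subseteq> {ds. length ds = snd P}) \<and> completed lt (ground_rules \<Omega> v) (intens \<Omega>) (T E'))"
    by (simp add: completion_def sat_FPExs listing fin sat_C C_def[symmetric] intens_def[symmetric])
  also have "\<dots> \<longleftrightarrow> ?R" (is "?L \<longleftrightarrow> _")
  proof
    assume ?L
    then obtain E' where E': "completed lt (ground_rules \<Omega> v) (intens \<Omega>) (T E')" by blast
    let ?X = "{a \<in> T E'. pred_of a \<in> ?K}"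
    have "{a \<in> ?X. pred_of a \<in> pub_preds \<Omega>} = {a \<in> truths. pred_of a \<in> pub_preds \<Omega>}"
      using K by (auto simp: T_def)
    moreover have "completed lt (ground_rules \<Omega> v) (intens \<Omega>) ?X" using E' restrict by blast
    ultimately show ?R by (intro exI[of _ ?X]) blast
  next
    assume ?R
    then obtain X where X:
      "{a \<in> X. pred_of a \<in> pub_preds \<Omega>} = {a \<in> truths. pred_of a \<in> pub_preds \<Omega>}"
      "\<forall>a\<in>X. pred_of a \<in> ?K" "completed lt (ground_rules \<Omega> v) (intens \<Omega>) X" by blast
    define E' where "E' P = (if P \<in> ?Q then {ds. length ds = snd P \<and> (fst P, ds) \<in> X} else E P)" for P
    have "snd a \<in> E' (pred_of a) \<longleftrightarrow> a \<in> X" if "pred_of a \<in> ?Q" for a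
      using that by (cases a) (simp add: E'_def pred_of_def)
    then have "a \<in> {a \<in> T E'. pred_of a \<in> ?K} \<longleftrightarrow> a \<in> X" for a
      using X(1,2) K unfolding T_def by (cases "pred_of a \<in> ?Q") auto
    then have TX: "{a \<in> T E'. pred_of a \<in> ?K} = X" by blast
    have "completed lt (ground_rules \<Omega> v) (intens \<Omega>) (T E')"
      using X(3) restrict[of "T E'"] unfolding TX by blast
    then show ?L by (intro exI[of _ E']) (auto simp: E'_def)
  qed
  finally show ?thesis .
qed

lemma sat_completion_iff_io_model:
  assumes io: "io_program \<Omega>" and PH: "placeholders \<Omega> = PH"
    and tight: "locally_tight lt \<Omega> v {a \<in> truths. pred_of a \<in> ins \<Omega>}"
  shows "sat M e E (completion \<Omega>) \<longleftrightarrow>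
    io_model lt \<Omega> v {a \<in> truths. pred_of a \<in> ins \<Omega>} {a \<in> truths. pred_of a \<in> pub_preds \<Omega>}"
proof -
  let ?I = "{a \<in> truths. pred_of a \<in> ins \<Omega>}"
  let ?J = "{a \<in> truths. pred_of a \<in> pub_preds \<Omega>}"
  let ?st = "stable_model lt (val_program (placeholders \<Omega>) v (rules \<Omega>) \<union> fact_rule ` ?I)"
  let ?c = "\<lambda>X. (\<forall>a\<in>X. pred_of a \<in> ins \<Omega> \<union> intens \<Omega>) \<and> completed lt (ground_rules \<Omega> v) (intens \<Omega>) X"
  \<comment> \<open>Fixing the public part also fixes the input part, so the two directions proved
    for \<open>stable_model\<close> and \<open>completed\<close> apply with the same input.\<close>
  have "?st X \<longleftrightarrow> ?c X" if "{a \<in> X. pred_of a \<in> pub_preds \<Omega>} = ?J" for X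
  proof
    assume "?st X"
    from stable_model_completed[OF io _ this] show "?c X" by blast
  next
    assume c: "?c X"
    have "{a \<in> X. pred_of a \<in> ins \<Omega>} = ?I" using that by (auto simp: pub_preds_def)
    with c show "?st X" using completed_stable_model[OF io tight] by blast
  qed
  then show ?thesis unfolding sat_completion[OF io PH] io_model_def by blast
qed

end

section \<open>Assumptions and the final equivalence\<close>

text \<open>Standardness determines \<open>absf\<close> and \<open>opf\<close> only on numerals. Two
  standard interpretations thus agree on integer terms only under assignments that respect the
  integer sort, an invariant carried through the induction.\<close>

lemma sat_standard_cong:
  assumes "standard_for lt PH M" "standard_for lt PH N" "cst M = cst N"
    and "first_order F" "\<And>i. e (IV i) \<in> range Num"
    and "\<And>p ds. (p, length ds) \<in> preds F \<Longrightarrow> prd M p ds \<longleftrightarrow> prd N p ds"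
  shows "sat M e E F \<longleftrightarrow> sat N e E F"
proof -
  have dom: "sort_dom N x = sort_dom M x" for x
    using assms(1,2) by (cases x) (auto simp: standard_for_def)
  have i: "itm_val N e t = itm_val M e t \<and> itm_val M e t \<in> range Num"
    if "\<And>i. e (IV i) \<in> range Num" for e t
    using that assms(1-3) by (induction t) (auto simp: standard_for_def)
  have g: "gtm_val N e t = gtm_val M e t" if "\<And>i. e (IV i) \<in> range Num" for e t
  proof -
    have "itm_val N e t = itm_val M e t" for t using i[of e t] that by blast
    then show ?thesis using assms(3) by (cases t) auto
  qed
  have upd: "(e(x := d)) (IV i) \<in> range Num"
    if "\<And>i. e (IV i) \<in> range Num" "d \<in> sort_dom M x" for e x d i
    using that assms(1) by (cases x) (auto simp: standard_for_def)
  have rel: "relf M c r s \<longleftrightarrow> relf N c r s" if "c \<noteq> EQ" for c r s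
    using that assms(1,2) by (auto simp: standard_for_def)
  show ?thesis using assms(4-)
  proof (induction F arbitrary: e)
    case (FPred p ts)
    have "map (gtm_val N e) ts = map (gtm_val M e) ts" using g FPred(2) by simp
    then show ?case using FPred(3) by (simp del: map_eq_conv)
  next
    case (FRel c t u)
    then show ?case using g rel by simp
  next
    case (FAnd F G)
    then show ?case by simp
  next
    case (FOr F G)
    then show ?case by simp
  next
    case (FImp F G)
    then show ?case by simp
  next
    case (FAll x F)
    have "sat M (e(x := d)) E F \<longleftrightarrow> sat N (e(x := d)) E F" if "d \<in> sort_dom M x" for d
      using FAll that upd by simp
    then show ?case by (simp add: dom)
  next
    case (FEx x F)
    have "sat M (e(x := d)) E F \<longleftrightarrow> sat N (e(x := d)) E F" if "d \<in> sort_dom M x" for d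
      using FEx that upd by simp
    then show ?case by (simp add: dom)
  qed auto
qed

lemma sat_assumption:
  assumes M: "standard_interp lt PH v M" and v: "valuation_on PH v"
    and A: "assumption_for \<Omega> A"
    and I: "\<And>p ds. (p, length ds) \<in> ins \<Omega> \<Longrightarrow> (p, ds) \<in> I \<longleftrightarrow> prd M p ds"
  shows "sat M e E A \<longleftrightarrow> models (interp_of lt PH v I) A"
proof -
  interpret standard_interp lt PH v M by (rule M)
  let ?N = "interp_of lt PH v I"
  have A: "first_order A" "fv A = {}" "preds A \<subseteq> ins \<Omega>" using A by (auto simp: assumption_for_def)
  \<comment> \<open>The given assignment may be ill-sorted; as \<open>A\<close> is a sentence, it
    can be exchanged for one that maps integer variables to numerals.\<close>
  have "sat M e E A \<longleftrightarrow> sat M (\<lambda>_. Num 0) E A" using A by (intro sat_cong) auto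
  also have "\<dots> \<longleftrightarrow> sat ?N (\<lambda>_. Num 0) E A"
    using std standard_for_interp_of[OF v] A I cst
    by (intro sat_standard_cong) (auto simp: interp_of_def)
  also have "\<dots> \<longleftrightarrow> models ?N A"
    using sat_cong[OF A(1), where M = ?N] A(2) unfolding models_def by blast
  finally show ?thesis .
qed

theorem theorem3:
  fixes lt :: "'s::{countable,infinite} pterm \<Rightarrow> 's pterm \<Rightarrow> bool"
    and \<Omega> \<Omega>' :: "'s io_prog" and PH :: "'s set" and A :: "'s fm"
  assumes "precomputed_order lt"
    and "io_program \<Omega>" and "io_program \<Omega>'"
    and "comparable \<Omega> \<Omega>'" and "placeholders \<Omega> = PH"
    and "assumption_for \<Omega> A"
    and "locally_tight_under lt \<Omega> A" and "locally_tight_under lt \<Omega>' A"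
  shows "equivalent_under lt \<Omega> \<Omega>' A \<longleftrightarrow>
    (\<forall>M :: ('s, 's pterm) interp. standard_for lt PH M \<longrightarrow>
       models M (FImp A (FIff (completion \<Omega>) (completion \<Omega>'))))"
proof -
  have comp: "placeholders \<Omega>' = PH" "ins \<Omega>' = ins \<Omega>" "pub_preds \<Omega>' = pub_preds \<Omega>"
    using assms(4,5) by (auto simp: comparable_def pub_preds_def)
  have dom': "in_domain lt \<Omega>' A v I \<longleftrightarrow> in_domain lt \<Omega> A v I" for v I
    using comp assms(5) by (simp add: in_domain_def is_input_def)
  \<comment> \<open>The core of the argument: for one interpretation the sentence compares the two
    programs on one candidate, the public atoms \<open>T\<close> makes true, under the input read
    off from \<open>T\<close>. Both directions are instances of this.\<close>
  have key: "sat M e E (FImp A (FIff (completion \<Omega>) (completion \<Omega>'))) \<longleftrightarrow>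
      (in_domain lt \<Omega> A v {a \<in> T. pred_of a \<in> ins \<Omega>} \<longrightarrow>
        (io_model lt \<Omega> v {a \<in> T. pred_of a \<in> ins \<Omega>} {a \<in> T. pred_of a \<in> pub_preds \<Omega>} \<longleftrightarrow>
         io_model lt \<Omega>' v {a \<in> T. pred_of a \<in> ins \<Omega>} {a \<in> T. pred_of a \<in> pub_preds \<Omega>}))"
    if M: "standard_interp lt PH v M" and v: "valuation_on PH v" and T: "T = {(p, rs). prd M p rs}"
    for M v T e E
  proof -
    interpret standard_interp lt PH v M by (rule M)
    let ?I = "{a \<in> T. pred_of a \<in> ins \<Omega>}"
    have T: "truths = T" by (simp add: truths_def T)
    have dom: "in_domain lt \<Omega> A v ?I \<longleftrightarrow> sat M e E A"
      using sat_assumption[OF M v assms(6), of ?I e E] assms(5) v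
      by (auto simp: in_domain_def is_input_def pred_of_def T[symmetric] truths_def)
    have "sat M e E (completion \<Omega>) \<longleftrightarrow> io_model lt \<Omega> v ?I {a \<in> T. pred_of a \<in> pub_preds \<Omega>}"
      if "in_domain lt \<Omega> A v ?I"
      using sat_completion_iff_io_model[OF assms(2,5)] assms(7) that
      by (simp add: T locally_tight_under_def)
    moreover have "sat M e E (completion \<Omega>') \<longleftrightarrow> io_model lt \<Omega>' v ?I {a \<in> T. pred_of a \<in> pub_preds \<Omega>}"
      if "in_domain lt \<Omega> A v ?I"
      using sat_completion_iff_io_model[OF assms(3) comp(1)] assms(8) that
      by (simp add: T locally_tight_under_def comp dom')
    ultimately show ?thesis using dom by simp
  qed
  show ?thesis
  proof
    assume eq: "equivalent_under lt \<Omega> \<Omega>' A"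
    show "\<forall>M :: ('s, 's pterm) interp. standard_for lt PH M \<longrightarrow>
        models M (FImp A (FIff (completion \<Omega>) (completion \<Omega>')))"
    proof (intro allI impI)
      fix M :: "('s, 's pterm) interp" assume M: "standard_for lt PH M"
      \<comment> \<open>The valuation is read off from the denotations of the placeholders; other
        constants denote themselves.\<close>
      define v where "v c = cst M (Sym c)" for c
      have "cst M r = apply_val PH v r" for r
        using M by (cases r) (auto simp: standard_for_def apply_val_def v_def)
      then have M': "standard_interp lt PH v M"
        using M assms(1) by (auto simp: standard_interp_def)
      have v: "valuation_on PH v" using M by (auto simp: standard_for_def valuation_on_def v_def)
      show "models M (FImp A (FIff (completion \<Omega>) (completion \<Omega>')))"
        using eq unfolding models_def key[OF M' v refl] equivalent_under_def by blast
    qed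
  next
    assume R: "\<forall>M :: ('s, 's pterm) interp. standard_for lt PH M \<longrightarrow>
        models M (FImp A (FIff (completion \<Omega>) (completion \<Omega>')))"
    have "io_model lt \<Omega> v I J \<longleftrightarrow> io_model lt \<Omega>' v I J" if dom: "in_domain lt \<Omega> A v I" for v I J
    \<comment> \<open>If \<open>J\<close> passes this test, the interpretation with true atoms
      \<open>J\<close> represents both the input and the candidate. If not, \<open>J\<close> is an
      io-model of neither program, since io-models consist of public atoms and have input part
      \<open>I\<close>.\<close>
    proof (cases "{a \<in> J. pred_of a \<in> ins \<Omega>} = I \<and> (\<forall>a\<in>J. pred_of a \<in> pub_preds \<Omega>)")
      case True
      let ?M = "interp_of lt PH v J"
      have v: "valuation_on PH v" using dom assms(5) by (simp add: in_domain_def is_input_def)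
      have std: "standard_for lt PH ?M" by (rule standard_for_interp_of[OF v])
      then have M: "standard_interp lt PH v ?M"
        using assms(1) by (simp add: standard_interp_def interp_of_def)
      have J: "J = {(p, rs). prd ?M p rs}" "{a \<in> J. pred_of a \<in> pub_preds \<Omega>} = J"
        using True by (auto simp: interp_of_def)
      have sat: "sat ?M e E (FImp A (FIff (completion \<Omega>) (completion \<Omega>')))" for e E
        using R std unfolding models_def by blast
      have I: "{a \<in> J. pred_of a \<in> ins \<Omega>} = I" using True by blast
      show ?thesis using sat dom unfolding key[OF M v J(1)] J(2) I by blast
    next
      case False
      have I: "\<forall>a\<in>I. pred_of a \<in> ins \<Omega>" using dom by (simp add: in_domain_def is_input_def)
      have "\<not> io_model lt \<Psi> v I J"
        if "io_program \<Psi>" "ins \<Psi> = ins \<Omega>" "pub_preds \<Psi> = pub_preds \<Omega>" for \<Psi>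
      proof
        assume "io_model lt \<Psi> v I J"
        then obtain X where
          X: "stable_model lt (val_program (placeholders \<Psi>) v (rules \<Psi>) \<union> fact_rule ` I) X"
            "J = {a \<in> X. pred_of a \<in> pub_preds \<Psi>}"
          unfolding io_model_def by blast
        have "{a \<in> X. pred_of a \<in> ins \<Omega>} = I"
          using stable_model_completed(2)[OF that(1) _ X(1)] I that(2) by simp
        with False X(2) that(3) show False by (auto simp: pub_preds_def)
      qed
      then show ?thesis using assms(2,3) comp by blast
    qed
    then show "equivalent_under lt \<Omega> \<Omega>' A" by (simp add: equivalent_under_def)
  qed
qed

end
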